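(* There is a permutation model $\mathcal{N}$ of ZFA in which there is an amorphous set and moreover: (1) if in a partially ordered set all chains are finite and all antichains are countable, then the set is countable; (2) for every regular $\aleph_\alpha$, if in a partially ordered set all chains are finite and all antichains have size at most $\aleph_\alpha$, then the set has size at most $\aleph_\alpha$.
   Context: An infinite set is amorphous if it cannot be written as a disjoint union of two infinite subsets. "Countable" means of cardinality at most $\aleph_0$. *)

theory Defs
  imports "HOL-Algebra.Bij"
begin

section \<open>Structures for the language of set theory with atoms\<close>

record 'a zfa_struct =
  Univ :: "'a set"
  Mem :: "'a \<Rightarrow> 'a \<Rightarrow> bool"
  Atoms :: "'a set"

definition is_set :: "'a zfa_struct \<Rightarrow> 'a \<Rightarrow> bool" where
  "is_set M x \<longleftrightarrow> x \<in> Univ M \<and> x \<notin> Atoms M"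

text \<open>The extension of an object: the HOL set of those elements of the universe that the
  structure believes to be its members.\<close>

definition elts :: "'a zfa_struct \<Rightarrow> 'a \<Rightarrow> 'a set" where
  "elts M x = {y \<in> Univ M. Mem M y x}"

text \<open>First-order formulas with numbered variables; \<^term>\<open>FAll i p\<close> binds variable i.\<close>

datatype fm =
    FMem nat nat
  | FEq nat nat
  | FAtom nat
  | FNeg fm
  | FAnd fm fm
  | FAll nat fm

primrec sat :: "'a zfa_struct \<Rightarrow> fm \<Rightarrow> (nat \<Rightarrow> 'a) \<Rightarrow> bool" where
  "sat M (FMem i j) e \<longleftrightarrow> Mem M (e i) (e j)"
| "sat M (FEq i j) e \<longleftrightarrow> e i = e j"
| "sat M (FAtom i) e \<longleftrightarrow> e i \<in> Atoms M"
| "sat M (FNeg p) e \<longleftrightarrow> \<not> sat M p e"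
| "sat M (FAnd p q) e \<longleftrightarrow> sat M p e \<and> sat M q e"
| "sat M (FAll i p) e \<longleftrightarrow> (\<forall>x\<in>Univ M. sat M p (e(i := x)))"

text \<open>Binary relations definable by a formula with parameters from the structure: variables 0
  and 1 are the arguments, all other variables are parameters.\<close>

definition definable_rels :: "'a zfa_struct \<Rightarrow> ('a \<Rightarrow> 'a \<Rightarrow> bool) set" where
  "definable_rels M = {R. \<exists>p e. range e \<subseteq> Univ M \<and>
      R = (\<lambda>x y. sat M p (e(0 := x, 1 := y)))}"

text \<open>The axioms of ZFA, where separation and replacement range over a given collection K of
  binary relations (a unary class being a relation with fixed second argument).
  \<open>K = definable_rels M\<close> gives the usual first-order axiom schemas; \<open>K = UNIV\<close> gives
  their second-order versions.\<close>

definition zfa_axioms :: "'a zfa_struct \<Rightarrow> ('a \<Rightarrow> 'a \<Rightarrow> bool) set \<Rightarrow> bool" where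
  "zfa_axioms M K \<longleftrightarrow>
     \<comment> \<open>atoms\<close>
     Atoms M \<subseteq> Univ M \<and>
     (\<forall>a\<in>Atoms M. elts M a = {}) \<and>
     (\<exists>a. is_set M a \<and> elts M a = Atoms M) \<and>
     \<comment> \<open>empty set\<close>
     (\<exists>z. is_set M z \<and> elts M z = {}) \<and>
     \<comment> \<open>extensionality\<close>
     (\<forall>x y. is_set M x \<longrightarrow> is_set M y \<longrightarrow> elts M x = elts M y \<longrightarrow> x = y) \<and>
     \<comment> \<open>pairing\<close>
     (\<forall>x\<in>Univ M. \<forall>y\<in>Univ M. \<exists>z. is_set M z \<and> elts M z = {x, y}) \<and>
     \<comment> \<open>union\<close>
     (\<forall>x. is_set M x \<longrightarrow> (\<exists>u. is_set M u \<and> elts M u = (\<Union>y\<in>elts M x. elts M y))) \<and>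
     \<comment> \<open>power set\<close>
     (\<forall>x. is_set M x \<longrightarrow>
        (\<exists>w. is_set M w \<and> elts M w = {y. is_set M y \<and> elts M y \<subseteq> elts M x})) \<and>
     \<comment> \<open>infinity\<close>
     (\<exists>w. is_set M w \<and> (\<exists>z\<in>elts M w. is_set M z \<and> elts M z = {}) \<and>
        (\<forall>x\<in>elts M w. \<exists>s\<in>elts M w. is_set M s \<and> elts M s = insert x (elts M x))) \<and>
     \<comment> \<open>foundation\<close>
     (\<forall>x. is_set M x \<longrightarrow> elts M x \<noteq> {} \<longrightarrow> (\<exists>y\<in>elts M x. elts M y \<inter> elts M x = {})) \<and>
     \<comment> \<open>separation\<close>
     (\<forall>R\<in>K. \<forall>x. is_set M x \<longrightarrow> (\<forall>c\<in>Univ M.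
        \<exists>z. is_set M z \<and> elts M z = {y \<in> elts M x. R y c})) \<and>
     \<comment> \<open>replacement\<close>
     (\<forall>R\<in>K. \<forall>x. is_set M x \<longrightarrow>
        (\<forall>t\<in>elts M x. \<forall>y\<in>Univ M. \<forall>y'\<in>Univ M. R t y \<longrightarrow> R t y' \<longrightarrow> y = y') \<longrightarrow>
        (\<exists>z. is_set M z \<and> elts M z = {y \<in> Univ M. \<exists>t\<in>elts M x. R t y}))"

definition zfa_model :: "'a zfa_struct \<Rightarrow> bool" where
  "zfa_model M \<longleftrightarrow> zfa_axioms M (definable_rels M)"


section \<open>Set-theoretic notions inside a structure\<close>

text \<open>Everything in this section is relativized: all quantifiers over sets, relations and
  functions range over the universe of the structure.\<close>

definition is_upair :: "'a zfa_struct \<Rightarrow> 'a \<Rightarrow> 'a \<Rightarrow> 'a \<Rightarrow> bool" where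
  "is_upair M z x y \<longleftrightarrow> is_set M z \<and> elts M z = {x, y}"

definition is_pair :: "'a zfa_struct \<Rightarrow> 'a \<Rightarrow> 'a \<Rightarrow> 'a \<Rightarrow> bool" where
  "is_pair M p x y \<longleftrightarrow> (\<exists>u v. is_upair M u x x \<and> is_upair M v x y \<and> is_upair M p u v)"

definition rel_of :: "'a zfa_struct \<Rightarrow> 'a \<Rightarrow> 'a \<Rightarrow> 'a \<Rightarrow> bool" where
  "rel_of M r x y \<longleftrightarrow> (\<exists>p\<in>elts M r. is_pair M p x y)"

definition is_rel :: "'a zfa_struct \<Rightarrow> 'a \<Rightarrow> 'a \<Rightarrow> 'a \<Rightarrow> bool" where
  "is_rel M r a b \<longleftrightarrow> is_set M r \<and>
     (\<forall>p\<in>elts M r. \<exists>x\<in>elts M a. \<exists>y\<in>elts M b. is_pair M p x y)"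

definition is_fun :: "'a zfa_struct \<Rightarrow> 'a \<Rightarrow> 'a \<Rightarrow> 'a \<Rightarrow> bool" where
  "is_fun M f a b \<longleftrightarrow> is_rel M f a b \<and> (\<forall>x\<in>elts M a. \<exists>!y. rel_of M f x y)"

definition is_inj :: "'a zfa_struct \<Rightarrow> 'a \<Rightarrow> 'a \<Rightarrow> 'a \<Rightarrow> bool" where
  "is_inj M f a b \<longleftrightarrow> is_fun M f a b \<and>
     (\<forall>x x' y. rel_of M f x y \<longrightarrow> rel_of M f x' y \<longrightarrow> x = x')"

definition is_bij :: "'a zfa_struct \<Rightarrow> 'a \<Rightarrow> 'a \<Rightarrow> 'a \<Rightarrow> bool" where
  "is_bij M f a b \<longleftrightarrow> is_inj M f a b \<and> (\<forall>y\<in>elts M b. \<exists>x\<in>elts M a. rel_of M f x y)"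

definition card_le :: "'a zfa_struct \<Rightarrow> 'a \<Rightarrow> 'a \<Rightarrow> bool" where
  "card_le M a b \<longleftrightarrow> (\<exists>f. is_inj M f a b)"

definition equipotent :: "'a zfa_struct \<Rightarrow> 'a \<Rightarrow> 'a \<Rightarrow> bool" where
  "equipotent M a b \<longleftrightarrow> (\<exists>f. is_bij M f a b)"

text \<open>Ordinals: transitive sets of sets that are (strictly) well-ordered by membership.\<close>

definition is_ord :: "'a zfa_struct \<Rightarrow> 'a \<Rightarrow> bool" where
  "is_ord M k \<longleftrightarrow> is_set M k \<and>
     (\<forall>x\<in>elts M k. is_set M x \<and> elts M x \<subseteq> elts M k) \<and>
     irreflp_on (elts M k) (Mem M) \<and> transp_on (elts M k) (Mem M) \<and>
     totalp_on (elts M k) (Mem M) \<and>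
     (\<forall>s. is_set M s \<longrightarrow> elts M s \<subseteq> elts M k \<longrightarrow> elts M s \<noteq> {} \<longrightarrow>
        (\<exists>x\<in>elts M s. \<forall>y\<in>elts M s. x = y \<or> Mem M x y))"

text \<open>Natural numbers: ordinals such that they and all their elements are zero or successors.\<close>

definition is_nat :: "'a zfa_struct \<Rightarrow> 'a \<Rightarrow> bool" where
  "is_nat M n \<longleftrightarrow> is_ord M n \<and>
     (\<forall>k \<in> insert n (elts M n). elts M k = {} \<or> (\<exists>j\<in>Univ M. elts M k = insert j (elts M j)))"

definition is_omega :: "'a zfa_struct \<Rightarrow> 'a \<Rightarrow> bool" where
  "is_omega M w \<longleftrightarrow> is_set M w \<and> elts M w = {n. is_nat M n}"

definition finite_in :: "'a zfa_struct \<Rightarrow> 'a \<Rightarrow> bool" where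
  "finite_in M x \<longleftrightarrow> (\<exists>n. is_nat M n \<and> equipotent M x n)"

definition countable_in :: "'a zfa_struct \<Rightarrow> 'a \<Rightarrow> bool" where
  "countable_in M x \<longleftrightarrow> (\<exists>w. is_omega M w \<and> card_le M x w)"

definition amorphous :: "'a zfa_struct \<Rightarrow> 'a \<Rightarrow> bool" where
  "amorphous M x \<longleftrightarrow> is_set M x \<and> \<not> finite_in M x \<and>
     \<not> (\<exists>y z. is_set M y \<and> is_set M z \<and> elts M y \<union> elts M z = elts M x \<and>
          elts M y \<inter> elts M z = {} \<and> \<not> finite_in M y \<and> \<not> finite_in M z)"

text \<open>The alephs are the infinite initial ordinals. So no indexing by ordinals is needed in
  order to quantify over all of them.\<close>

definition is_aleph :: "'a zfa_struct \<Rightarrow> 'a \<Rightarrow> bool" where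
  "is_aleph M k \<longleftrightarrow> is_ord M k \<and> \<not> finite_in M k \<and> (\<forall>b\<in>elts M k. \<not> equipotent M b k)"

definition cofinal_fun :: "'a zfa_struct \<Rightarrow> 'a \<Rightarrow> 'a \<Rightarrow> 'a \<Rightarrow> bool" where
  "cofinal_fun M f b k \<longleftrightarrow> is_fun M f b k \<and>
     (\<forall>c\<in>elts M k. \<exists>x\<in>elts M b. \<exists>y. rel_of M f x y \<and> (c = y \<or> Mem M c y))"

definition regular_aleph :: "'a zfa_struct \<Rightarrow> 'a \<Rightarrow> bool" where
  "regular_aleph M k \<longleftrightarrow> is_aleph M k \<and> \<not> (\<exists>b\<in>elts M k. \<exists>f. cofinal_fun M f b k)"

definition is_poset :: "'a zfa_struct \<Rightarrow> 'a \<Rightarrow> 'a \<Rightarrow> bool" where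
  "is_poset M p r \<longleftrightarrow> is_set M p \<and> is_rel M r p p \<and>
     reflp_on (elts M p) (rel_of M r) \<and> antisymp_on (elts M p) (rel_of M r) \<and>
     transp_on (elts M p) (rel_of M r)"

definition is_chain :: "'a zfa_struct \<Rightarrow> 'a \<Rightarrow> 'a \<Rightarrow> 'a \<Rightarrow> bool" where
  "is_chain M p r c \<longleftrightarrow> is_set M c \<and> elts M c \<subseteq> elts M p \<and> totalp_on (elts M c) (rel_of M r)"

text \<open>Antichains are sets of pairwise incomparable (not: pairwise incompatible) elements.\<close>

definition is_antichain :: "'a zfa_struct \<Rightarrow> 'a \<Rightarrow> 'a \<Rightarrow> 'a \<Rightarrow> bool" where
  "is_antichain M p r c \<longleftrightarrow> is_set M c \<and> elts M c \<subseteq> elts M p \<and>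
     pairwise (\<lambda>x y. \<not> rel_of M r x y \<and> \<not> rel_of M r y x) (elts M c)"

definition choice :: "'a zfa_struct \<Rightarrow> bool" where
  "choice M \<longleftrightarrow> (\<forall>x. is_set M x \<longrightarrow> (\<forall>y\<in>elts M x. elts M y \<noteq> {}) \<longrightarrow>
     (\<exists>b f. is_set M b \<and> is_fun M f x b \<and> (\<forall>y z. rel_of M f y z \<longrightarrow> z \<in> elts M y)))"


section \<open>Universes and permutation models\<close>

text \<open>A universe of ZFA + AC plays the role of the ambient class of all sets and atoms: arbitrary
  HOL predicates and functions on it count as classes, so separation and replacement are
  assumed for all of them. Consequently every HOL permutation of the atoms, every HOL set of such
  permutations, and so on, corresponds to an element of the universe, and groups and filters
  can be taken as HOL objects. A universe of ZFC is one without atoms.\<close>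

definition zfac_universe :: "'a zfa_struct \<Rightarrow> bool" where
  "zfac_universe M \<longleftrightarrow> zfa_axioms M UNIV \<and> choice M"

definition zfc_universe :: "'a zfa_struct \<Rightarrow> bool" where
  "zfc_universe M \<longleftrightarrow> zfac_universe M \<and> Atoms M = {}"

text \<open>The extension of a permutation of the atoms to the whole universe, by the
  \<open>\<in>\<close>-recursion \<open>\<pi>(x) = {\<pi>(t) | t \<in> x}\<close>. Membership of a universe is well-founded, so the
  recursion equation holds there.\<close>

definition lift_perm :: "'a zfa_struct \<Rightarrow> ('a \<Rightarrow> 'a) \<Rightarrow> 'a \<Rightarrow> 'a" where
  "lift_perm M \<pi> = wfrec {(t, x). x \<in> Univ M \<and> t \<in> elts M x}
     (\<lambda>f x. if x \<in> Atoms M then \<pi> x else (THE y. is_set M y \<and> elts M y = f ` elts M x))"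

text \<open>Normal filters on a group G of permutations of the set A (composition of permutations is
  multiplication in \<^term>\<open>BijGroup A\<close>).\<close>

definition normal_filter :: "'a set \<Rightarrow> ('a \<Rightarrow> 'a) set \<Rightarrow> ('a \<Rightarrow> 'a) set set \<Rightarrow> bool" where
  "normal_filter A G F \<longleftrightarrow>
     (\<forall>H\<in>F. subgroup H (BijGroup A) \<and> H \<subseteq> G) \<and>
     G \<in> F \<and>
     (\<forall>H K. H \<in> F \<longrightarrow> subgroup K (BijGroup A) \<longrightarrow> H \<subseteq> K \<longrightarrow> K \<subseteq> G \<longrightarrow> K \<in> F) \<and>
     (\<forall>H\<in>F. \<forall>K\<in>F. H \<inter> K \<in> F) \<and>
     (\<forall>\<pi>\<in>G. \<forall>H\<in>F. (\<lambda>h. \<pi> \<otimes>\<^bsub>BijGroup A\<^esub> h \<otimes>\<^bsub>BijGroup A\<^esub> inv\<^bsub>BijGroup A\<^esub> \<pi>) ` H \<in> F) \<and>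
     (\<forall>a\<in>A. {\<pi>\<in>G. \<pi> a = a} \<in> F)"

definition sym_group :: "'a zfa_struct \<Rightarrow> ('a \<Rightarrow> 'a) set \<Rightarrow> 'a \<Rightarrow> ('a \<Rightarrow> 'a) set" where
  "sym_group M G x = {\<pi>\<in>G. lift_perm M \<pi> x = x}"

inductive_set hered_sym ::
    "'a zfa_struct \<Rightarrow> ('a \<Rightarrow> 'a) set \<Rightarrow> ('a \<Rightarrow> 'a) set set \<Rightarrow> 'a set"
  for M G F where
  "x \<in> Univ M \<Longrightarrow> sym_group M G x \<in> F \<Longrightarrow> (\<And>y. y \<in> elts M x \<Longrightarrow> y \<in> hered_sym M G F) \<Longrightarrow>
     x \<in> hered_sym M G F"

definition permutation_model :: "'a zfa_struct \<Rightarrow> bool" where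
  "permutation_model N \<longleftrightarrow>
     (\<exists>M G F. zfac_universe M \<and> subgroup G (BijGroup (Atoms M)) \<and>
        normal_filter (Atoms M) G F \<and>
        N = \<lparr>Univ = hered_sym M G F, Mem = Mem M, Atoms = Atoms M\<rparr>)"

end

theory Submission
  imports Defs "HOL-Library.Equipollence" "HOL-Combinatorics.Cycles" "HOL-Algebra.Group_Action"
begin

text \<open>The model is the basic Fraenkel model: infinitely many atoms, all permutations, finite supports.
  Let \<open>E\<close> be a finite support of a partially ordered set. Every orbit under the permutations fixing
  \<open>E\<close> pointwise is an antichain, because on a given element such a permutation acts like one of
  finite order. If antichains inject into an ordinal, all elements of an orbit therefore have a
  common finite support, and moving atoms outside it shows that \<open>E\<close> itself supports each element.
  So all subsets of the partial order belong to the model, and it remains to see, with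
  choice, that a partial order without infinite chains whose antichains have size at most \<open>K\<close> has
  size at most \<open>K\<close>.\<close>

section \<open>Sets without infinite cliques and with small independent sets\<close>

text \<open>The given universe has no atoms and the model has to live on the same HOL type, so the
  atoms must be made out of sets: the odd numerals give up their role as sets, and the even ones
  take over for all numerals. Separation and replacement for arbitrary HOL predicates make every HOL
  subset of a set again a set of the universe, so that membership in the model becomes a question of
  symmetry alone, and choice comes from HOL. The combinatorial lemma can therefore be proved about
  HOL sets. What could obstruct its use is that HOL sees more chains, antichains and injections than
  the model does; a common support of all elements closes this gap, since every set of pairs of such
  elements with elements of an ordinal is symmetric. The passage from a common support of an orbit
  to \<open>E\<close> needs fresh atoms outside any given finite set, hence infinitely many
  atoms.\<close>

lemma UNION_lepoll_infinite:
  assumes "infinite B" "I \<lesssim> B" "\<And>i. i \<in> I \<Longrightarrow> X i \<lesssim> B"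
  shows "(\<Union>i\<in>I. X i) \<lesssim> B"
  using assms card_of_UNION_ordLeq_infinite[of B I X]
  unfolding lepoll_def card_of_ordLeq[symmetric] by blast

text \<open>Zorn's lemma; independence concerns two points at a time, so it passes to unions of
  chains. Maximality is phrased as domination because the use made of it is that the neighbourhoods
  of \<open>A\<close> cover \<open>P\<close>.\<close>

lemma maximal_independent_set_exists:
  obtains A where "A \<subseteq> P" "pairwise (\<lambda>x y. \<not> Q x y \<and> \<not> Q y x) A"
    "\<And>x. x \<in> P \<Longrightarrow> \<exists>a\<in>A. x = a \<or> Q a x \<or> Q x a"
proof -
  let ?F = "{A. A \<subseteq> P \<and> pairwise (\<lambda>x y. \<not> Q x y \<and> \<not> Q y x) A}"
  have "\<exists>A\<in>?F. \<forall>X\<in>?F. A \<subseteq> X \<longrightarrow> X = A"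
  proof (rule subset_Zorn')
    fix C assume "subset.chain ?F C"
    then have "C \<subseteq> ?F" and tot: "\<And>X Y. X \<in> C \<Longrightarrow> Y \<in> C \<Longrightarrow> X \<subseteq> Y \<or> Y \<subseteq> X"
      by (auto simp: subset_chain_def)
    moreover have "pairwise (\<lambda>x y. \<not> Q x y \<and> \<not> Q y x) (\<Union>C)"
      unfolding pairwise_def
    proof safe
      fix x y X Y assume xy: "x \<in> X" "X \<in> C" "y \<in> Y" "Y \<in> C" "x \<noteq> y"
      then obtain Z where "Z \<in> C" "x \<in> Z" "y \<in> Z"
        using tot by blast
      then have nq: "\<not> Q x y \<and> \<not> Q y x"
        using \<open>C \<subseteq> ?F\<close> xy(5) unfolding pairwise_def by blast
      show False if "Q x y" using that nq by blast
      show False if "Q y x" using that nq by blast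
    qed
    moreover have "\<Union>C \<subseteq> P" using \<open>C \<subseteq> ?F\<close> by blast
    ultimately show "\<Union>C \<in> ?F" by simp
  qed
  then obtain A where A: "A \<in> ?F" and max: "\<forall>X\<in>?F. A \<subseteq> X \<longrightarrow> X = A"
    by (elim bexE)
  have "\<exists>a\<in>A. x = a \<or> Q a x \<or> Q x a" if "x \<in> P" for x
  proof (rule ccontr)
    assume c: "\<not> ?thesis"
    then have "\<forall>a\<in>A. \<not> Q a x \<and> \<not> Q x a" by blast
    then have "insert x A \<in> ?F"
      using A that by (simp add: pairwise_insert)
    from max[rule_format, OF this] c show False by blast
  qed
  with A show thesis using that by blast
qed

text \<open>A set of size above \<open>K\<close> contains some \<open>a\<close> comparable to more than \<open>K\<close> of its elements,
  as otherwise the neighbourhoods of a maximal independent set would not cover it; iterating this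
  yields an infinite clique.\<close>

lemma lepoll_if_cliques_finite_independent_sets_lepoll:
  assumes K: "infinite K"
    and cliques: "\<And>C. C \<subseteq> P \<Longrightarrow> (\<And>x y. x \<in> C \<Longrightarrow> y \<in> C \<Longrightarrow> x \<noteq> y \<Longrightarrow> Q x y \<or> Q y x) \<Longrightarrow> finite C"
    and indep: "\<And>C. C \<subseteq> P \<Longrightarrow> pairwise (\<lambda>x y. \<not> Q x y \<and> \<not> Q y x) C \<Longrightarrow> C \<lesssim> K"
  shows "P \<lesssim> K"
proof (rule ccontr)
  assume big: "\<not> P \<lesssim> K"
  define nbrs where "nbrs a S = {x \<in> S. x \<noteq> a \<and> (Q a x \<or> Q x a)}" for a S
  have step: "\<exists>a\<in>S. \<not> nbrs a S \<lesssim> K" if S: "S \<subseteq> P" "\<not> S \<lesssim> K" for S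
  proof (rule ccontr)
    assume small: "\<not> ?thesis"
    obtain A where A: "A \<subseteq> S" "pairwise (\<lambda>x y. \<not> Q x y \<and> \<not> Q y x) A"
      "\<And>x. x \<in> S \<Longrightarrow> \<exists>a\<in>A. x = a \<or> Q a x \<or> Q x a"
      using maximal_independent_set_exists[of S Q] by blast
    have "A \<lesssim> K" using A S indep by blast
    moreover have "insert a (nbrs a S) \<lesssim> K" if "a \<in> A" for a
    \<comment> \<open>Adding \<open>a\<close> leaves the cardinality unchanged when the
      neighbourhood is infinite; a finite set embeds into \<open>K\<close> anyway.\<close>
    proof (cases "finite (nbrs a S)")
      case True
      then show ?thesis using K finite_lepoll_infinite by blast
    next
      case False
      have "nbrs a S \<lesssim> K" using small that A(1) by blast
      then show ?thesis
        by (rule lepoll_trans1[OF infinite_insert_eqpoll[OF False]])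
    qed
    ultimately have "(\<Union>a\<in>A. insert a (nbrs a S)) \<lesssim> K"
      by (rule UNION_lepoll_infinite[OF K])
    moreover have "S \<subseteq> (\<Union>a\<in>A. insert a (nbrs a S))"
      using A(3) by (auto simp: nbrs_def)
    ultimately have "S \<lesssim> K" by (rule lepoll_trans[OF subset_imp_lepoll, rotated])
    then show False using S(2) by simp
  qed
  define pick where "pick S = (SOME a. a \<in> S \<and> \<not> nbrs a S \<lesssim> K)" for S
  have pick: "pick S \<in> S" "\<not> nbrs (pick S) S \<lesssim> K" if "S \<subseteq> P" "\<not> S \<lesssim> K" for S
    using someI_ex[of "\<lambda>a. a \<in> S \<and> \<not> nbrs a S \<lesssim> K"] step[OF that] by (auto simp: pick_def)
  \<comment> \<open>\<open>T (Suc n)\<close> keeps the elements of \<open>T n\<close> adjacent to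
    the point picked from \<open>T n\<close>, so every later pick is adjacent to all earlier ones.
    Not embedding into \<open>K\<close> is the invariant that keeps the construction going.\<close>
  define T where "T = rec_nat P (\<lambda>_ S. nbrs (pick S) S)"
  have T0: "T 0 = P" and TS: "T (Suc n) = nbrs (pick (T n)) (T n)" for n
    by (simp_all add: T_def)
  have T: "T n \<subseteq> P \<and> \<not> T n \<lesssim> K" for n
  proof (induction n)
    case 0 then show ?case using big by (simp add: T0)
  next
    case (Suc n)
    then show ?case using pick[of "T n"] by (auto simp: TS nbrs_def)
  qed
  define c where "c n = pick (T n)" for n
  have anti: "T m \<subseteq> T n" if "n \<le> m" for n m
    using that by (induction rule: dec_induct) (auto simp: TS nbrs_def)
  have adj: "c m \<noteq> c n \<and> (Q (c n) (c m) \<or> Q (c m) (c n))" if "n < m" for n m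
  proof -
    have "c m \<in> T m" using pick T by (simp add: c_def)
    then have "c m \<in> T (Suc n)" using anti[of "Suc n" m] that by auto
    then show ?thesis by (auto simp: TS nbrs_def c_def)
  qed
  have "finite (range c)"
  proof (rule cliques)
    show "range c \<subseteq> P" using pick T unfolding c_def by blast
    show "Q x y \<or> Q y x" if "x \<in> range c" "y \<in> range c" "x \<noteq> y" for x y
      using that adj by (metis imageE linorder_neqE_nat)
  qed
  moreover have "inj c"
    by (rule linorder_injI) (use adj in metis)
  ultimately show False using finite_imageD by blast
qed


section \<open>Universes with second-order separation and replacement\<close>

text \<open>With \<open>small\<close> and \<open>coll\<close>, the axioms become closure properties
  of HOL sets, and the sets they provide need not be named. On a set that is not
  \<open>small\<close>, \<open>coll\<close> has an unspecified value.\<close>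

definition small :: "'a zfa_struct \<Rightarrow> 'a set \<Rightarrow> bool" where
  "small M X \<longleftrightarrow> (\<exists>z. is_set M z \<and> elts M z = X)"

definition coll :: "'a zfa_struct \<Rightarrow> 'a set \<Rightarrow> 'a" where
  "coll M X = (THE z. is_set M z \<and> elts M z = X)"

text \<open>The von Neumann numerals. They serve as a copy of the natural numbers inside the
  universe, as the witness for infinity in permutation models and as the supply of atoms.\<close>

primrec num :: "'a zfa_struct \<Rightarrow> nat \<Rightarrow> 'a" where
  "num M 0 = coll M {}"
| "num M (Suc n) = coll M (insert (num M n) (elts M (num M n)))"

definition opair :: "'a zfa_struct \<Rightarrow> 'a \<Rightarrow> 'a \<Rightarrow> 'a" where
  "opair M x y = coll M {coll M {x, x}, coll M {x, y}}"

lemma elts_subset_Univ: "elts M x \<subseteq> Univ M"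
  by (auto simp: elts_def)

lemma is_set_Univ: "is_set M x \<Longrightarrow> x \<in> Univ M"
  by (simp add: is_set_def)

locale zfa_universe =
  fixes M :: "'a zfa_struct"
  assumes axioms: "zfa_axioms M UNIV"
begin

section \<open>The axioms as separate facts\<close>

lemma Atoms_subset_Univ: "Atoms M \<subseteq> Univ M"
  using axioms unfolding zfa_axioms_def by (elim conjE)

lemma elts_atom: "a \<in> Atoms M \<Longrightarrow> elts M a = {}"
proof -
  have "\<forall>a\<in>Atoms M. elts M a = {}"
    using axioms unfolding zfa_axioms_def by (elim conjE)
  then show "a \<in> Atoms M \<Longrightarrow> ?thesis" by simp
qed

lemma small_Atoms: "small M (Atoms M)"
  using axioms unfolding zfa_axioms_def small_def by (elim conjE)

lemma small_empty: "small M {}"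
  using axioms unfolding zfa_axioms_def small_def by (elim conjE)

lemma is_set_eqI: "is_set M x \<Longrightarrow> is_set M y \<Longrightarrow> elts M x = elts M y \<Longrightarrow> x = y"
proof -
  have "\<forall>x y. is_set M x \<longrightarrow> is_set M y \<longrightarrow> elts M x = elts M y \<longrightarrow> x = y"
    using axioms unfolding zfa_axioms_def by (elim conjE)
  then show "is_set M x \<Longrightarrow> is_set M y \<Longrightarrow> elts M x = elts M y \<Longrightarrow> ?thesis" by simp
qed

lemma small_pair: "x \<in> Univ M \<Longrightarrow> y \<in> Univ M \<Longrightarrow> small M {x, y}"
proof -
  have "\<forall>x\<in>Univ M. \<forall>y\<in>Univ M. \<exists>z. is_set M z \<and> elts M z = {x, y}"
    using axioms unfolding zfa_axioms_def by (elim conjE)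
  then show "x \<in> Univ M \<Longrightarrow> y \<in> Univ M \<Longrightarrow> ?thesis" unfolding small_def by simp
qed

lemma small_Union_elts: "is_set M x \<Longrightarrow> small M (\<Union>y\<in>elts M x. elts M y)"
proof -
  have "\<forall>x. is_set M x \<longrightarrow> (\<exists>u. is_set M u \<and> elts M u = (\<Union>y\<in>elts M x. elts M y))"
    using axioms unfolding zfa_axioms_def by (elim conjE)
  then show "is_set M x \<Longrightarrow> ?thesis" unfolding small_def by simp
qed

lemma small_Pow_elts: "is_set M x \<Longrightarrow> small M {y. is_set M y \<and> elts M y \<subseteq> elts M x}"
proof -
  have "\<forall>x. is_set M x \<longrightarrow>
        (\<exists>w. is_set M w \<and> elts M w = {y. is_set M y \<and> elts M y \<subseteq> elts M x})"
    using axioms unfolding zfa_axioms_def by (elim conjE)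
  then show "is_set M x \<Longrightarrow> ?thesis" unfolding small_def by simp
qed

lemma infinity:
  "\<exists>w. is_set M w \<and> (\<exists>z\<in>elts M w. is_set M z \<and> elts M z = {}) \<and>
     (\<forall>x\<in>elts M w. \<exists>s\<in>elts M w. is_set M s \<and> elts M s = insert x (elts M x))"
  using axioms unfolding zfa_axioms_def by (elim conjE)

lemma foundation: "is_set M x \<Longrightarrow> elts M x \<noteq> {} \<Longrightarrow> \<exists>y\<in>elts M x. elts M y \<inter> elts M x = {}"
proof -
  have "\<forall>x. is_set M x \<longrightarrow> elts M x \<noteq> {} \<longrightarrow> (\<exists>y\<in>elts M x. elts M y \<inter> elts M x = {})"
    using axioms unfolding zfa_axioms_def by (elim conjE)
  then show "is_set M x \<Longrightarrow> elts M x \<noteq> {} \<Longrightarrow> ?thesis" by simp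
qed

lemma separation:
  assumes "is_set M x"
  shows "small M {y \<in> elts M x. Q y}"
proof -
  have "\<forall>R\<in>UNIV. \<forall>x. is_set M x \<longrightarrow> (\<forall>c\<in>Univ M.
        \<exists>z. is_set M z \<and> elts M z = {y \<in> elts M x. R y c})"
    using axioms unfolding zfa_axioms_def by (elim conjE)
  then have "\<forall>x. is_set M x \<longrightarrow> (\<forall>c\<in>Univ M.
        \<exists>z. is_set M z \<and> elts M z = {y \<in> elts M x. Q y})"
    by (rule bspec[of _ _ "\<lambda>y _. Q y"]) simp
  from this[THEN spec, THEN mp, OF assms] is_set_Univ[OF assms]
  show ?thesis unfolding small_def by (rule bspec)
qed

lemma replacement:
  assumes "is_set M x"
    "\<And>t y y'. t \<in> elts M x \<Longrightarrow> y \<in> Univ M \<Longrightarrow> y' \<in> Univ M \<Longrightarrow> R t y \<Longrightarrow> R t y' \<Longrightarrow> y = y'"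
  shows "small M {y \<in> Univ M. \<exists>t\<in>elts M x. R t y}"
proof -
  have "\<forall>R\<in>UNIV. \<forall>x. is_set M x \<longrightarrow>
        (\<forall>t\<in>elts M x. \<forall>y\<in>Univ M. \<forall>y'\<in>Univ M. R t y \<longrightarrow> R t y' \<longrightarrow> y = y') \<longrightarrow>
        (\<exists>z. is_set M z \<and> elts M z = {y \<in> Univ M. \<exists>t\<in>elts M x. R t y})"
    using axioms unfolding zfa_axioms_def by (elim conjE)
  note this[THEN bspec, OF UNIV_I, THEN spec, THEN mp, THEN mp, of x R]
  then show ?thesis unfolding small_def using assms by simp
qed

section \<open>HOL sets that are extensions of sets\<close>

lemma is_set_coll: "small M X \<Longrightarrow> is_set M (coll M X)"
  and elts_coll: "small M X \<Longrightarrow> elts M (coll M X) = X"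
proof -
  assume "small M X"
  then obtain z where z: "is_set M z" "elts M z = X" by (auto simp: small_def)
  have "coll M X = z" unfolding coll_def
    by (rule the_equality) (use z is_set_eqI in simp_all)
  with z show "is_set M (coll M X)" "elts M (coll M X) = X" by simp_all
qed

lemma coll_elts: "is_set M x \<Longrightarrow> coll M (elts M x) = x"
  using is_set_eqI[of "coll M (elts M x)" x] is_set_coll elts_coll unfolding small_def by metis

lemma coll_in_Univ: "small M X \<Longrightarrow> coll M X \<in> Univ M"
  by (simp add: is_set_coll is_set_Univ)

lemma coll_eq_iff: "small M X \<Longrightarrow> small M Y \<Longrightarrow> coll M X = coll M Y \<longleftrightarrow> X = Y"
  by (metis elts_coll)

lemma small_elts: "x \<in> Univ M \<Longrightarrow> small M (elts M x)"
  using elts_atom small_empty by (cases "x \<in> Atoms M") (auto simp: small_def is_set_def)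

lemma small_subset_Univ: "small M X \<Longrightarrow> X \<subseteq> Univ M"
  by (auto simp: small_def elts_def)

text \<open>Second-order separation with membership in \<open>Y\<close> as the predicate: every HOL
  subset counts, definable or not.\<close>

lemma small_subset: "small M X \<Longrightarrow> Y \<subseteq> X \<Longrightarrow> small M Y"
  using separation[of "coll M X" "\<lambda>y. y \<in> Y"]
  by (simp add: is_set_coll elts_coll Int_absorb1 Collect_conj_eq)

lemma small_image:
  assumes "small M X" "f ` X \<subseteq> Univ M"
  shows "small M (f ` X)"
proof -
  have "small M {y \<in> Univ M. \<exists>t\<in>elts M (coll M X). y = f t}"
    using assms by (intro replacement) (auto simp: is_set_coll)
  moreover have "{y \<in> Univ M. \<exists>t\<in>elts M (coll M X). y = f t} = f ` X"
    using assms by (auto simp: elts_coll)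
  ultimately show ?thesis by simp
qed

lemma small_UNION:
  assumes "small M X" "\<And>x. x \<in> X \<Longrightarrow> small M (g x)"
  shows "small M (\<Union>x\<in>X. g x)"
proof -
  let ?f = "\<lambda>x. coll M (g x)"
  have *: "small M (?f ` X)"
    using assms by (intro small_image) (auto simp: coll_in_Univ)
  have "small M (\<Union>y\<in>?f ` X. elts M y)"
    using small_Union_elts[OF is_set_coll[OF *]] by (simp only: elts_coll[OF *])
  moreover have "(\<Union>y\<in>?f ` X. elts M y) = (\<Union>x\<in>X. g x)"
    using assms by (auto simp: elts_coll)
  ultimately show ?thesis by simp
qed

lemma small_Un:
  assumes "small M X" "small M Y" shows "small M (X \<union> Y)"
proof -
  have xy: "coll M X \<in> Univ M" "coll M Y \<in> Univ M" using assms by (auto simp: coll_in_Univ)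
  have "small M (\<Union>x\<in>{coll M X, coll M Y}. elts M x)"
    by (rule small_UNION) (use small_pair[OF xy] xy small_elts in auto)
  then show ?thesis using assms by (simp add: elts_coll)
qed

lemma small_insert: "x \<in> Univ M \<Longrightarrow> small M X \<Longrightarrow> small M (insert x X)"
  using small_Un[of "{x, x}" X] small_pair[of x x] by simp

lemma small_finite: "finite X \<Longrightarrow> X \<subseteq> Univ M \<Longrightarrow> small M X"
  by (induction rule: finite_induct) (auto simp: small_empty small_insert)

lemma small_Pow: "small M X \<Longrightarrow> small M {y. is_set M y \<and> elts M y \<subseteq> X}"
  using small_Pow_elts[of "coll M X"] by (simp add: is_set_coll elts_coll)

section \<open>Numerals and countable families\<close>

lemma is_set_num: "is_set M (num M n)"
  and elts_num: "elts M (num M n) = num M ` {..<n}"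
proof (induction n)
  case 0
  { case 1 show ?case by (simp add: is_set_coll small_empty) }
  { case 2 show ?case by (simp add: elts_coll small_empty) }
next
  case (Suc n)
  have s: "small M (insert (num M n) (elts M (num M n)))"
    using Suc(1)[THEN is_set_Univ] by (intro small_insert small_elts)
  { case 1 show ?case using s by (simp add: is_set_coll) }
  { case 2 show ?case using s Suc by (simp add: elts_coll lessThan_Suc) }
qed

declare num.simps [simp del]

lemma num_in_Univ: "num M n \<in> Univ M"
  by (rule is_set_Univ[OF is_set_num])

lemma not_mem_self: "x \<notin> elts M x"
proof
  assume x: "x \<in> elts M x"
  then have "x \<in> Univ M" by (simp add: elts_def)
  then have s: "small M {x}" using small_pair[of x x] by simp
  from foundation[OF is_set_coll[OF s]] x show False by (simp add: elts_coll[OF s])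
qed

lemma inj_num: "inj (num M)"
proof (rule linorder_injI)
  fix m n :: nat assume "m < n"
  then have "num M m \<in> elts M (num M n)" by (simp add: elts_num)
  then show "num M m \<noteq> num M n" using not_mem_self by metis
qed

lemma small_range_num: "small M (range (num M))"
proof -
  obtain w where w: "is_set M w" "\<exists>z\<in>elts M w. is_set M z \<and> elts M z = {}"
     "\<forall>x\<in>elts M w. \<exists>s\<in>elts M w. is_set M s \<and> elts M s = insert x (elts M x)"
    using infinity by blast
  have "num M n \<in> elts M w" for n
  proof (induction n)
    case 0
    obtain z where z: "z \<in> elts M w" "is_set M z" "elts M z = {}" using w(2) by blast
    then have "num M 0 = z" using is_set_eqI[OF is_set_num[of 0]] elts_num[of 0] by simp
    then show ?case using z by simp
  next
    case (Suc n)
    have "insert (num M n) (elts M (num M n)) = elts M (num M (Suc n))"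
      unfolding elts_num by (simp add: lessThan_Suc)
    then show ?case using w(3) Suc is_set_eqI is_set_num by metis
  qed
  then show ?thesis
    using small_subset[of "elts M w" "range (num M)"] w(1) by (auto simp: small_def)
qed

text \<open>Replacement along the set of numerals, with \<open>f\<close> transported by the inverse
  of \<open>num M\<close>.\<close>

lemma small_range:
  fixes f :: "nat \<Rightarrow> 'a"
  assumes "range f \<subseteq> Univ M" shows "small M (range f)"
proof -
  have "small M ((f \<circ> inv_into UNIV (num M)) ` range (num M))"
    using assms by (intro small_image small_range_num) auto
  moreover have "(f \<circ> inv_into UNIV (num M)) ` range (num M) = range f"
    using inj_num by (force simp: image_iff)
  ultimately show ?thesis by simp
qed

section \<open>Well-foundedness of membership\<close>

abbreviation mem_rel :: "('a \<times> 'a) set" where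
  "mem_rel \<equiv> {(t, x). x \<in> Univ M \<and> t \<in> elts M x}"

text \<open>Foundation is an axiom about sets only, but a descending HOL sequence has a set as its
  range by \<open>small_range\<close>, and that set would have no minimal member.\<close>

lemma wf_mem_rel: "wf mem_rel"
  unfolding wf_iff_no_infinite_down_chain
proof
  assume "\<exists>f. \<forall>i. (f (Suc i), f i) \<in> mem_rel"
  then obtain f where f: "\<And>i. f i \<in> Univ M" "\<And>i. f (Suc i) \<in> elts M (f i)" by blast
  then have s: "small M (range f)" by (intro small_range) auto
  obtain i where "elts M (f i) \<inter> range f = {}"
    using foundation[OF is_set_coll[OF s]] by (auto simp: elts_coll[OF s])
  then show False using f(2)[of i] by blast
qed

lemma mem_induct [consumes 1, case_names step]:
  assumes "x \<in> Univ M"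
    and "\<And>x. x \<in> Univ M \<Longrightarrow> (\<And>y. y \<in> elts M x \<Longrightarrow> P y) \<Longrightarrow> P x"
  shows "P x"
  using assms(1)
  by (induction rule: wf_induct_rule[OF wf_mem_rel]) (use assms(2) elts_def in fastforce)

lemma small_opair:
  assumes "x \<in> Univ M" "y \<in> Univ M"
  shows "small M {x, x}" "small M {x, y}" "small M {coll M {x, x}, coll M {x, y}}"
  using assms by (meson coll_in_Univ small_pair)+

lemma opair_eq_iff:
  assumes "x \<in> Univ M" "y \<in> Univ M" "x' \<in> Univ M" "y' \<in> Univ M"
  shows "opair M x y = opair M x' y' \<longleftrightarrow> x = x' \<and> y = y'"
  using assms small_opair[of x y] small_opair[of x' y']
  by (auto simp: opair_def coll_eq_iff doubleton_eq_iff)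

end


section \<open>Pairs and functions in transitive submodels\<close>

text \<open>Transitivity keeps extensions unchanged and closure under pairing keeps Kuratowski
  pairs, so \<open>N\<close> and \<open>M\<close> agree on pairs. The locale covers permutation
  models and also \<open>M\<close> itself.\<close>

locale transitive_submodel = zfa_universe +
  fixes N :: "'a zfa_struct"
  assumes Mem_N: "Mem N = Mem M"
    and Atoms_N: "Atoms N = Atoms M"
    and Univ_N: "Univ N \<subseteq> Univ M"
    and transitive: "x \<in> Univ N \<Longrightarrow> elts M x \<subseteq> Univ N"
    and pair_closed: "x \<in> Univ N \<Longrightarrow> y \<in> Univ N \<Longrightarrow> coll M {x, y} \<in> Univ N"
begin

lemma in_Univ: "x \<in> Univ N \<Longrightarrow> x \<in> Univ M"
  using Univ_N by blast

lemma elts_N: "x \<in> Univ N \<Longrightarrow> elts N x = elts M x"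
  using transitive[of x] Univ_N by (auto simp: elts_def Mem_N)

lemma is_set_N: "is_set N x \<longleftrightarrow> x \<in> Univ N \<and> is_set M x"
  using in_Univ by (auto simp: is_set_def Atoms_N)

lemma is_set_coll_N: "small M X \<Longrightarrow> coll M X \<in> Univ N \<Longrightarrow> is_set N (coll M X)"
  and elts_coll_N: "small M X \<Longrightarrow> coll M X \<in> Univ N \<Longrightarrow> elts N (coll M X) = X"
  by (auto simp: is_set_N is_set_coll elts_N elts_coll)

lemma is_upair_N_iff:
  assumes "x \<in> Univ N" "y \<in> Univ N"
  shows "is_upair N z x y \<longleftrightarrow> z = coll M {x, y}"
proof -
  have s: "small M {x, y}" using assms in_Univ small_pair by simp
  show ?thesis
  proof
    assume "is_upair N z x y"
    then have "z \<in> Univ N" "is_set M z" "elts N z = {x, y}"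
      by (simp_all add: is_upair_def is_set_N)
    then show "z = coll M {x, y}" using coll_elts[of z] elts_N[of z] by simp
  next
    assume "z = coll M {x, y}"
    then show "is_upair N z x y"
      using s assms pair_closed by (simp add: is_upair_def is_set_coll_N elts_coll_N)
  qed
qed

text \<open>Arguments outside \<open>N\<close> need no separate assumption: components of a pair of
  \<open>N\<close> are members of an object of \<open>N\<close>.\<close>

lemma is_pair_N_iff: "is_pair N p x y \<longleftrightarrow> x \<in> Univ N \<and> y \<in> Univ N \<and> p = opair M x y"
proof (cases "x \<in> Univ N \<and> y \<in> Univ N")
  case True
  then show ?thesis
    by (simp add: is_pair_def is_upair_N_iff opair_def pair_closed del: insert_absorb2)
next
  case False
  have "x \<in> Univ N \<and> y \<in> Univ N" if "is_upair N v x y" for v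
    using that elts_subset_Univ[of N v] by (auto simp: is_upair_def)
  then show ?thesis using False by (auto simp: is_pair_def)
qed

lemma rel_of_N_iff:
  "rel_of N r x y \<longleftrightarrow> x \<in> Univ N \<and> y \<in> Univ N \<and> opair M x y \<in> elts N r"
  by (auto simp: rel_of_def is_pair_N_iff)

lemma opair_in_Univ_N: "x \<in> Univ N \<Longrightarrow> y \<in> Univ N \<Longrightarrow> opair M x y \<in> Univ N"
  by (simp add: opair_def pair_closed del: insert_absorb2)

lemma rel_of_is_rel:
  assumes "is_rel N r a b" "rel_of N r x y"
  shows "x \<in> elts N a" "y \<in> elts N b"
proof -
  obtain x' y' where "x' \<in> elts N a" "y' \<in> elts N b" "is_pair N (opair M x y) x' y'"
    using assms unfolding is_rel_def rel_of_N_iff by blast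
  then show "x \<in> elts N a" "y \<in> elts N b"
    using assms(2) in_Univ by (auto simp: is_pair_N_iff rel_of_N_iff opair_eq_iff)
qed

lemma is_injE:
  assumes "is_inj N f a b"
  obtains h where "inj_on h (elts N a)" "h ` elts N a \<subseteq> elts N b"
    "\<And>x. x \<in> elts N a \<Longrightarrow> rel_of N f x (h x)"
proof -
  have "\<exists>y. rel_of N f x y" if "x \<in> elts N a" for x
    using assms that by (auto simp: is_inj_def is_fun_def)
  then obtain h where h: "\<And>x. x \<in> elts N a \<Longrightarrow> rel_of N f x (h x)" by metis
  have "inj_on h (elts N a)"
    using assms h unfolding inj_on_def is_inj_def by metis
  moreover have "h ` elts N a \<subseteq> elts N b"
    using assms h rel_of_is_rel(2) unfolding is_inj_def is_fun_def by blast
  ultimately show thesis using h that by blast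
qed

text \<open>This direction holds in general; conversely a HOL injection yields one of
  \<open>N\<close> only if its graph belongs to \<open>N\<close>.\<close>

lemma card_le_imp_lepoll: "card_le N a b \<Longrightarrow> elts N a \<lesssim> elts N b"
  unfolding card_le_def lepoll_def using is_injE by metis

section \<open>Graphs of HOL functions as functions of the submodel\<close>

definition graph :: "'a \<Rightarrow> ('a \<Rightarrow> 'a) \<Rightarrow> 'a set" where
  "graph a f = (\<lambda>x. opair M x (f x)) ` elts M a"

lemma mem_graph: "p \<in> graph a f \<longleftrightarrow> (\<exists>x\<in>elts M a. p = opair M x (f x))"
  by (auto simp: graph_def)

context
  fixes a b f
  assumes ab: "a \<in> Univ N" "b \<in> Univ N"
    and f: "f ` elts M a \<subseteq> elts M b"
begin

lemma small_graph: "small M (graph a f)"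
  and graph_subset: "graph a f \<subseteq> Univ N"
proof -
  have "x \<in> Univ N \<and> f x \<in> Univ N" if "x \<in> elts M a" for x
    using that ab f transitive by blast
  then show g: "graph a f \<subseteq> Univ N"
    by (auto simp: graph_def opair_in_Univ_N)
  show "small M (graph a f)"
    using g in_Univ ab unfolding graph_def by (intro small_image small_elts) auto
qed

context
  assumes g: "coll M (graph a f) \<in> Univ N"
begin

lemma rel_of_graph: "rel_of N (coll M (graph a f)) x y \<longleftrightarrow> x \<in> elts M a \<and> y = f x"
proof -
  have e: "elts N (coll M (graph a f)) = graph a f"
    using small_graph g by (simp add: elts_coll_N)
  have fx: "x \<in> Univ N \<and> f x \<in> Univ N" if "x \<in> elts M a" for x
    using that ab f transitive by blast
  show ?thesis
  proof
    assume "rel_of N (coll M (graph a f)) x y"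
    then obtain x' where "x \<in> Univ N" "y \<in> Univ N" "x' \<in> elts M a" "opair M x y = opair M x' (f x')"
      by (auto simp: rel_of_N_iff e mem_graph)
    then show "x \<in> elts M a \<and> y = f x"
      using fx[of x'] in_Univ by (auto simp: opair_eq_iff)
  next
    assume "x \<in> elts M a \<and> y = f x"
    then show "rel_of N (coll M (graph a f)) x y"
      using fx by (auto simp: rel_of_N_iff e mem_graph)
  qed
qed

lemma is_fun_graph: "is_fun N (coll M (graph a f)) a b"
proof -
  have e: "elts N (coll M (graph a f)) = graph a f"
    using small_graph g by (simp add: elts_coll_N)
  have "\<exists>x\<in>elts N a. \<exists>y\<in>elts N b. is_pair N p x y" if "p \<in> graph a f" for p
  proof -
    from that obtain x where "x \<in> elts M a" "p = opair M x (f x)" by (auto simp: mem_graph)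
    then show ?thesis using ab f transitive
      by (intro bexI[of _ x] bexI[of _ "f x"]) (auto simp: elts_N is_pair_N_iff)
  qed
  then show ?thesis
    using is_set_coll_N[OF small_graph g] ab
    by (simp add: is_fun_def is_rel_def e rel_of_graph elts_N)
qed

lemma is_inj_graph: "inj_on f (elts M a) \<Longrightarrow> is_inj N (coll M (graph a f)) a b"
  by (auto simp: is_inj_def is_fun_graph rel_of_graph inj_on_def)

lemma is_bij_graph: "bij_betw f (elts M a) (elts M b) \<Longrightarrow> is_bij N (coll M (graph a f)) a b"
  using ab by (auto simp: is_bij_def is_inj_graph rel_of_graph bij_betw_def elts_N)

end

end

end

context zfa_universe
begin

lemma transitive_submodel_self: "transitive_submodel M M"
  by unfold_locales (auto simp: elts_def small_pair coll_in_Univ)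

text \<open>Hilbert choice picks the members, and replacement for all HOL functions turns the
  selection into a set. Hence a universe altered so as to have atoms satisfies choice as soon as it
  satisfies the other axioms.\<close>

lemma choice: "choice M"
proof -
  interpret transitive_submodel M M by (rule transitive_submodel_self)
  show ?thesis unfolding choice_def
  proof (intro allI impI)
    fix x assume x: "is_set M x" and ne: "\<forall>y\<in>elts M x. elts M y \<noteq> {}"
    define f where "f y = (SOME z. z \<in> elts M y)" for y
    have f: "f y \<in> elts M y" if "y \<in> elts M x" for y
      using that ne unfolding f_def by (simp add: some_in_eq)
    have sb: "small M (f ` elts M x)"
      using f is_set_Univ[OF x] by (intro small_image small_elts) (auto simp: elts_def)
    let ?b = "coll M (f ` elts M x)"
    have *: "x \<in> Univ M" "?b \<in> Univ M" "f ` elts M x \<subseteq> elts M ?b"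
      using x sb by (auto simp: is_set_Univ coll_in_Univ elts_coll)
    have g: "coll M (graph x f) \<in> Univ M"
      using small_graph[OF *] by (rule coll_in_Univ)
    have "is_set M ?b \<and> is_fun M (coll M (graph x f)) x ?b \<and>
       (\<forall>y z. rel_of M (coll M (graph x f)) y z \<longrightarrow> z \<in> elts M y)"
      using is_fun_graph[OF * g] rel_of_graph[OF * g] is_set_coll[OF sb] f by simp
    then show "\<exists>b f. is_set M b \<and> is_fun M f x b \<and> (\<forall>y z. rel_of M f y z \<longrightarrow> z \<in> elts M y)"
      by blast
  qed
qed

lemma zfac_universe: "zfac_universe M"
  by (simp add: zfac_universe_def axioms choice)

end


section \<open>Replacing the odd numerals by atoms\<close>

definition renum :: "'a zfa_struct \<Rightarrow> 'a \<Rightarrow> 'a" where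
  "renum V x = (if x \<in> range (num V) then num V (2 * inv_into UNIV (num V) x) else x)"

text \<open>The bijection \<^const>\<open>renum\<close> from the universe onto the complement of the new atoms transports
  membership on the right-hand side only. Each numeral is a subset of its double, so the new
  membership relation is contained in the old one and hence well-founded.\<close>

definition with_atoms :: "'a zfa_struct \<Rightarrow> 'a zfa_struct" where
  "with_atoms V = \<lparr>Univ = Univ V, Mem = (\<lambda>x z. \<exists>y\<in>Univ V. z = renum V y \<and> Mem V x y),
     Atoms = range (\<lambda>n. num V (2 * n + 1))\<rparr>"

locale pure_universe = zfa_universe V for V :: "'a zfa_struct" +
  assumes no_atoms: "Atoms V = {}"
begin

abbreviation "W \<equiv> with_atoms V"

lemma is_set_iff: "is_set V x \<longleftrightarrow> x \<in> Univ V"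
  by (simp add: is_set_def no_atoms)

lemma renum_num: "renum V (num V n) = num V (2 * n)"
  by (simp add: renum_def inv_f_f[OF inj_num])

lemma renum_other: "x \<notin> range (num V) \<Longrightarrow> renum V x = x"
  by (simp add: renum_def)

lemma num_eq_iff: "num V m = num V n \<longleftrightarrow> m = n"
  using inj_num by (simp add: inj_eq)

lemma renum_eq_iff: "renum V x = renum V y \<longleftrightarrow> x = y"
proof (cases "x \<in> range (num V)"; cases "y \<in> range (num V)")
qed (auto simp: renum_num renum_other num_eq_iff)

lemma renum_in_Univ: "x \<in> Univ V \<Longrightarrow> renum V x \<in> Univ V"
  by (simp add: renum_def num_in_Univ)

lemma renum_not_Atom: "renum V x \<notin> Atoms W"
proof (cases "x \<in> range (num V)")
  case True
  then show ?thesis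
    by (auto simp: renum_num with_atoms_def num_eq_iff) presburger
next
  case False
  then show ?thesis by (auto simp: renum_other with_atoms_def)
qed

lemma Univ_W: "Univ W = Univ V"
  by (simp add: with_atoms_def)

lemma is_set_W: "is_set W z \<longleftrightarrow> (\<exists>y\<in>Univ V. z = renum V y)"
proof
  assume z: "is_set W z"
  show "\<exists>y\<in>Univ V. z = renum V y"
  proof (cases "z \<in> range (num V)")
    case True
    then obtain n where n: "z = num V n" by blast
    moreover have "num V (2 * k + 1) \<in> Atoms W" for k by (simp add: with_atoms_def)
    ultimately have "even n" using z unfolding is_set_def by (metis oddE)
    then show ?thesis using n num_in_Univ renum_num by (metis evenE)
  next
    case False
    have "z \<in> Univ V" using z by (simp add: is_set_def Univ_W)
    with renum_other[OF False] show ?thesis by (intro bexI[of _ z]) simp_all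
  qed
next
  assume "\<exists>y\<in>Univ V. z = renum V y"
  then show "is_set W z"
    using renum_in_Univ renum_not_Atom by (auto simp: is_set_def Univ_W)
qed

lemma elts_W_renum: "y \<in> Univ V \<Longrightarrow> elts W (renum V y) = elts V y"
  by (auto simp: elts_def with_atoms_def renum_eq_iff)

lemma elts_W_Atom: "a \<in> Atoms W \<Longrightarrow> elts W a = {}"
proof -
  assume "a \<in> Atoms W"
  then have "a \<noteq> renum V y" for y using renum_not_Atom by blast
  then show ?thesis by (simp add: elts_def with_atoms_def)
qed

lemma elts_W_subset: "elts W z \<subseteq> elts V z"
proof
  fix x assume "x \<in> elts W z"
  then obtain y where y: "z = renum V y" "x \<in> elts V y"
    by (auto simp: elts_def with_atoms_def)
  show "x \<in> elts V z"
  proof (cases "y \<in> range (num V)")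
    case True
    then obtain n where "y = num V n" by blast
    then show ?thesis using y by (auto simp: renum_num elts_num)
  next
    case False
    then show ?thesis using y by (simp add: renum_other)
  qed
qed

text \<open>\<open>renum\<close> changes which object codes a given extension, but not which HOL
  sets are extensions. Axioms that assert the existence of a set with a prescribed extension
  therefore reduce to smallness in \<open>V\<close>.\<close>

lemma small_W: "small W X \<longleftrightarrow> small V X"
proof
  assume "small W X"
  then show "small V X" by (auto simp: small_def is_set_W is_set_iff elts_W_renum)
next
  assume "small V X"
  then obtain z where "z \<in> Univ V" "elts V z = X" by (auto simp: small_def is_set_iff)
  then show "small W X" using elts_W_renum unfolding small_def is_set_W by blast
qed

lemma infinity_W:
  "\<exists>w. is_set W w \<and> (\<exists>z\<in>elts W w. is_set W z \<and> elts W z = {}) \<and>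
        (\<forall>x\<in>elts W w. \<exists>s\<in>elts W w. is_set W s \<and> elts W s = insert x (elts W x))"
proof -
  \<comment> \<open>The numerals of \<open>V\<close> are not inductive for the new membership, since
    the odd ones have become atoms. So the successor is formed with \<open>elts W\<close> and
    iterated from the new empty set; the range of the iteration is the required set.\<close>
  define succ where "succ z = renum V (coll V (insert z (elts V (coll V (elts W z)))))" for z
  define t where "t n = (succ ^^ n) (renum V (coll V {}))" for n
  have el: "small V (elts W z)" if "z \<in> Univ V" for z
    using small_subset[OF small_elts[OF that] elts_W_subset] .
  have ins: "small V (insert z (elts V (coll V (elts W z))))" if "z \<in> Univ V" for z
    using that el by (simp add: small_insert elts_coll)
  have succ: "succ z \<in> Univ V" "is_set W (succ z)" "elts W (succ z) = insert z (elts W z)"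
    if "z \<in> Univ V" for z
    using ins[OF that] el[OF that] renum_in_Univ coll_in_Univ
    by (auto simp: succ_def is_set_W elts_W_renum elts_coll)
  have t: "t n \<in> Univ V" for n
    by (induction n) (simp_all add: t_def renum_in_Univ coll_in_Univ small_empty succ)
  then have "small W (range t)" unfolding small_W by (intro small_range) blast
  then obtain w where w: "is_set W w" "elts W w = range t" by (auto simp: small_def)
  have "is_set W (t 0)" "elts W (t 0) = {}"
    using small_empty coll_in_Univ by (auto simp: t_def is_set_W elts_W_renum elts_coll)
  moreover have "t (Suc n) = succ (t n)" for n by (simp add: t_def)
  then have "\<exists>s\<in>range t. is_set W s \<and> elts W s = insert x (elts W x)" if "x \<in> range t" for x
    using that succ t by (metis imageE rangeI)
  ultimately show ?thesis
    by (metis w rangeI)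
qed

lemma zfa_axioms_W: "zfa_axioms W UNIV"
  unfolding zfa_axioms_def small_def[symmetric]
proof (intro conjI ballI allI impI)
  show "Atoms W \<subseteq> Univ W" by (auto simp: with_atoms_def num_in_Univ)
  show "elts W a = {}" if "a \<in> Atoms W" for a using that by (rule elts_W_Atom)
  have "small V (range (\<lambda>n. num V (2 * n + 1)))"
    by (rule small_range) (use num_in_Univ in blast)
  then show "small W (Atoms W)" unfolding small_W by (simp add: with_atoms_def)
  show "small W {}" by (simp add: small_W small_empty)
  show "x = y" if "is_set W x" "is_set W y" "elts W x = elts W y" for x y
    using that is_set_eqI unfolding is_set_W by (metis elts_W_renum is_set_iff)
  show "small W {x, y}" if "x \<in> Univ W" "y \<in> Univ W" for x y
    using that by (simp add: small_W Univ_W small_pair)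
  have el: "small V (elts W z)" if "z \<in> Univ V" for z
    using small_subset[OF small_elts[OF that] elts_W_subset] .
  show "small W (\<Union>y\<in>elts W x. elts W y)" if "is_set W x" for x
    unfolding small_W
    by (intro small_UNION el) (use is_set_Univ[OF that] in \<open>auto simp: Univ_W elts_def\<close>)
  show "small W {y. is_set W y \<and> elts W y \<subseteq> elts W x}" if "is_set W x" for x
  proof -
    have "small V (elts W x)" using that is_set_Univ el Univ_W by metis
    then have "small V (renum V ` {y. is_set V y \<and> elts V y \<subseteq> elts W x})"
      using renum_in_Univ is_set_iff by (intro small_image small_Pow) auto
    moreover have "renum V ` {y. is_set V y \<and> elts V y \<subseteq> elts W x} =
        {y. is_set W y \<and> elts W y \<subseteq> elts W x}"
      by (auto simp: is_set_W is_set_iff elts_W_renum)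
    ultimately show ?thesis by (simp add: small_W)
  qed
  show "\<exists>w. is_set W w \<and> (\<exists>z\<in>elts W w. is_set W z \<and> elts W z = {}) \<and>
        (\<forall>x\<in>elts W w. \<exists>s\<in>elts W w. is_set W s \<and> elts W s = insert x (elts W x))"
    by (rule infinity_W)
  \<comment> \<open>A member minimal for the old membership is minimal for the new one, which is
    contained in it.\<close>
  show "\<exists>y\<in>elts W x. elts W y \<inter> elts W x = {}" if "is_set W x" "elts W x \<noteq> {}" for x
  proof -
    from that obtain y where "y \<in> Univ V" "x = renum V y" using that(1) by (auto simp: is_set_W)
    then have "\<exists>y\<in>elts W x. elts V y \<inter> elts W x = {}"
      using that(2) foundation[of y] by (simp add: elts_W_renum is_set_iff)
    then show ?thesis using elts_W_subset by blast
  qed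
  show "small W {y \<in> elts W x. R y c}" if "is_set W x" for R x c
    using small_subset[OF el, of x] is_set_Univ[OF that] by (simp add: small_W Univ_W)
  show "small W {y \<in> Univ W. \<exists>t\<in>elts W x. R t y}"
    if "is_set W x" and func: "\<forall>t\<in>elts W x. \<forall>y\<in>Univ W. \<forall>y'\<in>Univ W. R t y \<longrightarrow> R t y' \<longrightarrow> y = y'" for R x
  proof -
    from that(1) obtain z where "z \<in> Univ V" "x = renum V z" by (auto simp: is_set_W)
    moreover from this have "small V {y \<in> Univ V. \<exists>t\<in>elts V z. R t y}"
      using func by (intro replacement) (simp_all add: elts_W_renum is_set_iff Univ_W)
    ultimately show ?thesis by (simp add: small_W elts_W_renum Univ_W)
  qed
qed

lemma infinite_Atoms_W: "infinite (Atoms W)"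
proof -
  have "inj (\<lambda>n. num V (2 * n + 1))" by (simp add: inj_on_def num_eq_iff)
  then show ?thesis using finite_imageD by (auto simp: with_atoms_def)
qed

end

lemma zfa_universe_with_infinitely_many_atoms:
  fixes V :: "'a zfa_struct"
  assumes "zfc_universe V"
  obtains M :: "'a zfa_struct" where "zfa_universe M" "infinite (Atoms M)"
proof -
  interpret pure_universe V
    using assms by unfold_locales (auto simp: zfc_universe_def zfac_universe_def)
  show thesis
    using that zfa_universe.intro zfa_axioms_W infinite_Atoms_W by blast
qed


section \<open>The action of permutations of the atoms\<close>

context zfa_universe
begin

lemma lift_atom: "a \<in> Atoms M \<Longrightarrow> lift_perm M \<pi> a = \<pi> a"
  unfolding lift_perm_def by (subst wfrec[OF wf_mem_rel]) simp

text \<open>The recursion consults the permutation at atoms only. So a permutation can be exchanged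
  for its restriction to the atoms, the form in which \<open>Bij\<close> contains it.\<close>

lemma lift_cong:
  assumes "\<And>a. a \<in> Atoms M \<Longrightarrow> \<pi> a = \<sigma> a"
  shows "lift_perm M \<pi> = lift_perm M \<sigma>"
proof -
  have "(if x \<in> Atoms M then \<pi> x else y) = (if x \<in> Atoms M then \<sigma> x else y)" for x y
    using assms by simp
  then show ?thesis by (simp add: lift_perm_def)
qed

text \<open>The \<open>cut\<close> in the recursion disappears because members are predecessors. No
  smallness of the image is required: the description in \<open>lift_perm\<close> unfolds to
  \<open>coll\<close> of the image, whatever that denotes.\<close>

lemma lift_eq_coll: "is_set M x \<Longrightarrow> lift_perm M \<pi> x = coll M (lift_perm M \<pi> ` elts M x)"
proof -
  assume x: "is_set M x"
  have "cut f mem_rel x ` elts M x = f ` elts M x" for f :: "'a \<Rightarrow> 'a"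
    using is_set_Univ[OF x] by (intro image_cong) (simp_all add: cut_def)
  with x show ?thesis
    unfolding lift_perm_def by (subst wfrec[OF wf_mem_rel]) (simp add: is_set_def coll_def)
qed

lemma lift_in_Univ:
  assumes "x \<in> Univ M" "\<pi> ` Atoms M \<subseteq> Atoms M"
  shows "lift_perm M \<pi> x \<in> Univ M"
  using assms(1)
proof (induction rule: mem_induct)
  case (step x)
  show ?case
  proof (cases "x \<in> Atoms M")
    case True
    then show ?thesis using assms(2) Atoms_subset_Univ by (auto simp: lift_atom)
  next
    case False
    then have "is_set M x" using step by (simp add: is_set_def)
    moreover have "small M (lift_perm M \<pi> ` elts M x)"
      using step by (intro small_image small_elts) auto
    ultimately show ?thesis by (simp add: lift_eq_coll coll_in_Univ)
  qed
qed

lemma small_lift_image: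
  assumes "small M X" "\<pi> ` Atoms M \<subseteq> Atoms M"
  shows "small M (lift_perm M \<pi> ` X)"
  using assms small_subset_Univ[OF assms(1)] by (intro small_image) (auto intro: lift_in_Univ)

lemma lift_coll:
  assumes "small M X"
  shows "lift_perm M \<pi> (coll M X) = coll M (lift_perm M \<pi> ` X)"
  using assms by (simp add: lift_eq_coll is_set_coll elts_coll)

lemma is_set_lift:
  assumes "is_set M x" "\<pi> ` Atoms M \<subseteq> Atoms M"
  shows "is_set M (lift_perm M \<pi> x)"
  using assms small_lift_image[OF small_elts[OF is_set_Univ]] by (simp add: lift_eq_coll is_set_coll)

lemma elts_lift:
  assumes "x \<in> Univ M" "\<pi> ` Atoms M \<subseteq> Atoms M"
  shows "elts M (lift_perm M \<pi> x) = lift_perm M \<pi> ` elts M x"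
proof (cases "x \<in> Atoms M")
  case True
  then show ?thesis using assms by (auto simp: lift_atom elts_atom image_subset_iff)
next
  case False
  then have "is_set M x" using assms by (simp add: is_set_def)
  then show ?thesis
    using assms small_lift_image[OF small_elts] by (simp add: lift_eq_coll elts_coll)
qed

lemma lift_comp:
  assumes "x \<in> Univ M" "\<pi> ` Atoms M \<subseteq> Atoms M" "\<sigma> ` Atoms M \<subseteq> Atoms M"
  shows "lift_perm M \<pi> (lift_perm M \<sigma> x) = lift_perm M (\<pi> \<circ> \<sigma>) x"
  using assms(1)
proof (induction rule: mem_induct)
  case (step x)
  show ?case
  proof (cases "x \<in> Atoms M")
    case True
    then show ?thesis using assms(3) by (simp add: lift_atom image_subset_iff)
  next
    case False
    then have x: "is_set M x" using step by (simp add: is_set_def)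
    have "lift_perm M \<pi> ` lift_perm M \<sigma> ` elts M x = lift_perm M (\<pi> \<circ> \<sigma>) ` elts M x"
      unfolding image_image by (intro image_cong refl step(2))
    then show ?thesis
      by (simp only: lift_eq_coll[OF is_set_lift[OF x assms(3)]] elts_lift[OF step(1) assms(3)]
          lift_eq_coll[OF x, of "\<pi> \<circ> \<sigma>"])
  qed
qed

lemma lift_id:
  assumes "x \<in> Univ M" "\<And>a. a \<in> Atoms M \<Longrightarrow> \<pi> a = a"
  shows "lift_perm M \<pi> x = x"
  using assms(1)
proof (induction rule: mem_induct)
  case (step x)
  show ?case
  proof (cases "x \<in> Atoms M")
    case True
    then show ?thesis using assms(2) by (simp add: lift_atom)
  next
    case False
    then have "is_set M x" using step by (simp add: is_set_def)
    then show ?thesis using step(2) by (simp add: lift_eq_coll coll_elts)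
  qed
qed

lemma bij_betw_image_Atoms:
  assumes "bij_betw \<pi> (Atoms M) (Atoms M)"
  shows "\<pi> ` Atoms M \<subseteq> Atoms M" "inv_into (Atoms M) \<pi> ` Atoms M \<subseteq> Atoms M"
  using assms bij_betw_inv_into[OF assms] by (simp_all add: bij_betw_def)

lemma lift_inv_into:
  assumes "x \<in> Univ M" "bij_betw \<pi> (Atoms M) (Atoms M)"
  shows "lift_perm M (inv_into (Atoms M) \<pi>) (lift_perm M \<pi> x) = x"
    and "lift_perm M \<pi> (lift_perm M (inv_into (Atoms M) \<pi>) x) = x"
  using assms bij_betw_image_Atoms[OF assms(2)]
  by (simp_all add: lift_comp lift_id bij_betw_inv_into_left bij_betw_inv_into_right)

lemma lift_eq_iff:
  assumes "x \<in> Univ M" "y \<in> Univ M" "bij_betw \<pi> (Atoms M) (Atoms M)"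
  shows "lift_perm M \<pi> x = lift_perm M \<pi> y \<longleftrightarrow> x = y"
  using lift_inv_into(1) assms by metis

lemma lift_in_Atoms_iff:
  assumes "x \<in> Univ M" "\<pi> ` Atoms M \<subseteq> Atoms M"
  shows "lift_perm M \<pi> x \<in> Atoms M \<longleftrightarrow> x \<in> Atoms M"
proof
  assume "lift_perm M \<pi> x \<in> Atoms M"
  then show "x \<in> Atoms M"
    using is_set_lift[of x \<pi>] assms by (auto simp: is_set_def)
next
  assume "x \<in> Atoms M"
  then show "lift_perm M \<pi> x \<in> Atoms M" using assms by (auto simp: lift_atom)
qed

lemma lift_mem_iff:
  assumes "x \<in> Univ M" "y \<in> Univ M" "bij_betw \<pi> (Atoms M) (Atoms M)"
  shows "lift_perm M \<pi> x \<in> elts M (lift_perm M \<pi> y) \<longleftrightarrow> x \<in> elts M y"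
proof -
  have "z \<in> Univ M" if "z \<in> elts M y" for z using that by (simp add: elts_def)
  then show ?thesis
    using assms bij_betw_image_Atoms[OF assms(3)] by (auto simp: elts_lift lift_eq_iff)
qed

lemma lift_opair:
  assumes "x \<in> Univ M" "y \<in> Univ M"
  shows "lift_perm M \<pi> (opair M x y) = opair M (lift_perm M \<pi> x) (lift_perm M \<pi> y)"
  using small_opair[OF assms] by (simp add: opair_def lift_coll)

lemma lift_num: "\<pi> ` Atoms M \<subseteq> Atoms M \<Longrightarrow> lift_perm M \<pi> (num M n) = num M n"
proof (induction n rule: less_induct)
  case (less n)
  have "lift_perm M \<pi> ` num M ` {..<n} = num M ` {..<n}"
    using less by (simp add: image_image)
  then show ?case
    using elts_lift[OF num_in_Univ less.prems] less.prems
    by (intro is_set_eqI is_set_lift is_set_num) (simp_all add: elts_num)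
qed

text \<open>The lift is an automorphism of \<open>N\<close>. For quantifiers it must map the
  universe of \<open>N\<close> onto itself, so that quantifying over objects and over their images
  is the same.\<close>

lemma sat_lift:
  assumes "Univ N \<subseteq> Univ M" "Mem N = Mem M" "Atoms N = Atoms M"
    and "bij_betw \<pi> (Atoms M) (Atoms M)" "lift_perm M \<pi> ` Univ N = Univ N"
    and "range e \<subseteq> Univ N"
  shows "sat N p (lift_perm M \<pi> \<circ> e) \<longleftrightarrow> sat N p e"
  using assms(6)
proof (induction p arbitrary: e)
  case (FMem i j)
  then have "e i \<in> Univ M" "e j \<in> Univ M" using assms(1) by blast+
  then show ?case
    using lift_mem_iff[OF _ _ assms(4), of "e i" "e j"]
      lift_in_Univ[OF _ bij_betw_image_Atoms(1)[OF assms(4)], of "e i"]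
    by (simp add: elts_def assms(2))
next
  case (FEq i j)
  then have "e i \<in> Univ M" "e j \<in> Univ M" using assms(1) by blast+
  then show ?case using lift_eq_iff[OF _ _ assms(4)] by simp
next
  case (FAtom i)
  then have "e i \<in> Univ M" using assms(1) by blast
  then show ?case
    using lift_in_Atoms_iff bij_betw_image_Atoms(1)[OF assms(4)] by (simp add: assms(3))
next
  case (FAll i p)
  have *: "sat N p ((lift_perm M \<pi> \<circ> e)(i := lift_perm M \<pi> x)) \<longleftrightarrow> sat N p (e(i := x))"
    if "x \<in> Univ N" for x
  proof -
    have "(lift_perm M \<pi> \<circ> e)(i := lift_perm M \<pi> x) = lift_perm M \<pi> \<circ> e(i := x)"
      by auto
    moreover have "range (e(i := x)) \<subseteq> Univ N" using FAll.prems that by auto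
    ultimately show ?thesis using FAll.IH by metis
  qed
  have "sat N (FAll i p) (lift_perm M \<pi> \<circ> e) \<longleftrightarrow>
      (\<forall>x\<in>lift_perm M \<pi> ` Univ N. sat N p ((lift_perm M \<pi> \<circ> e)(i := x)))"
    by (simp add: assms(5))
  also have "\<dots> \<longleftrightarrow> sat N (FAll i p) e"
    using * by simp
  finally show ?case .
qed simp_all

end

text \<open>An environment supplies infinitely many parameters, but a filter allows only finitely
  many of them to be fixed at once. A bound on the relevant variables is enough, so free variables
  need not be defined.\<close>

lemma sat_depends_on_finitely_many:
  "\<exists>n. \<forall>e e'. (\<forall>i<n. e i = e' i) \<longrightarrow> sat M p e = sat M p e'"
proof (induction p)
  case (FMem i j)
  show ?case by (rule exI[of _ "Suc (i + j)"]) simp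
next
  case (FEq i j)
  show ?case by (rule exI[of _ "Suc (i + j)"]) simp
next
  case (FAtom i)
  show ?case by (rule exI[of _ "Suc i"]) simp
next
  case (FNeg p)
  then show ?case by (metis sat.simps(4))
next
  case (FAnd p q)
  then obtain m n where
    "\<forall>e e'. (\<forall>i<m. e i = e' i) \<longrightarrow> sat M p e = sat M p e'"
    "\<forall>e e'. (\<forall>i<n. e i = e' i) \<longrightarrow> sat M q e = sat M q e'" by blast
  then show ?case
    by (intro exI[of _ "max m n"]) (metis less_max_iff_disj sat.simps(5))
next
  case (FAll j p)
  then obtain n where n: "\<forall>e e'. (\<forall>i<n. e i = e' i) \<longrightarrow> sat M p e = sat M p e'" by blast
  have "sat M p (e(j := x)) = sat M p (e'(j := x))" if "\<forall>i<n. e i = e' i" for e e' x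
    by (rule n[rule_format]) (use that in simp)
  then show ?case
    by (intro exI[of _ n] allI impI) (simp only: sat.simps)
qed


section \<open>Permutation models satisfy ZFA\<close>

locale permutation_submodel = zfa_universe +
  fixes G :: "('a \<Rightarrow> 'a) set" and F :: "('a \<Rightarrow> 'a) set set"
  assumes subgroup_G: "subgroup G (BijGroup (Atoms M))"
    and normal_filter: "normal_filter (Atoms M) G F"
begin

definition N :: "'a zfa_struct" where
  "N = \<lparr>Univ = hered_sym M G F, Mem = Mem M, Atoms = Atoms M\<rparr>"

lemma permutation_model_N: "permutation_model N"
  using zfac_universe subgroup_G normal_filter by (auto simp: permutation_model_def N_def)

section \<open>The properties of a normal filter\<close>

lemma filter_subgroup: "H \<in> F \<Longrightarrow> subgroup H (BijGroup (Atoms M))"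
  and filter_subset: "H \<in> F \<Longrightarrow> H \<subseteq> G"
proof -
  have "\<forall>H\<in>F. subgroup H (BijGroup (Atoms M)) \<and> H \<subseteq> G"
    using normal_filter unfolding normal_filter_def by (elim conjE)
  then show "H \<in> F \<Longrightarrow> subgroup H (BijGroup (Atoms M))" "H \<in> F \<Longrightarrow> H \<subseteq> G"
    by simp_all
qed

lemma G_in_filter: "G \<in> F"
  using normal_filter unfolding normal_filter_def by (elim conjE)

lemma filter_upward:
  assumes "H \<in> F" "subgroup K (BijGroup (Atoms M))" "H \<subseteq> K" "K \<subseteq> G"
  shows "K \<in> F"
proof -
  have "\<forall>H K. H \<in> F \<longrightarrow> subgroup K (BijGroup (Atoms M)) \<longrightarrow> H \<subseteq> K \<longrightarrow> K \<subseteq> G \<longrightarrow> K \<in> F"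
    using normal_filter unfolding normal_filter_def by (elim conjE)
  from this[rule_format, OF assms] show ?thesis .
qed

lemma filter_Int:
  assumes "H \<in> F" "K \<in> F"
  shows "H \<inter> K \<in> F"
proof -
  have "\<forall>H\<in>F. \<forall>K\<in>F. H \<inter> K \<in> F"
    using normal_filter unfolding normal_filter_def by (elim conjE)
  from this[rule_format, OF assms] show ?thesis .
qed

lemma filter_conj:
  assumes "\<pi> \<in> G" "H \<in> F"
  shows "(\<lambda>h. \<pi> \<otimes>\<^bsub>BijGroup (Atoms M)\<^esub> h \<otimes>\<^bsub>BijGroup (Atoms M)\<^esub> inv\<^bsub>BijGroup (Atoms M)\<^esub> \<pi>) ` H \<in> F"
proof -
  have "\<forall>\<pi>\<in>G. \<forall>H\<in>F. (\<lambda>h. \<pi> \<otimes>\<^bsub>BijGroup (Atoms M)\<^esub> h \<otimes>\<^bsub>BijGroup (Atoms M)\<^esub>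
      inv\<^bsub>BijGroup (Atoms M)\<^esub> \<pi>) ` H \<in> F"
    using normal_filter unfolding normal_filter_def by (elim conjE)
  from this[rule_format, OF assms] show ?thesis .
qed

lemma stabilizer_in_filter:
  assumes "a \<in> Atoms M"
  shows "{\<pi>\<in>G. \<pi> a = a} \<in> F"
proof -
  have "\<forall>a\<in>Atoms M. {\<pi>\<in>G. \<pi> a = a} \<in> F"
    using normal_filter unfolding normal_filter_def by (elim conjE)
  from this[rule_format, OF assms] show ?thesis .
qed

lemma G_Bij: "\<pi> \<in> G \<Longrightarrow> \<pi> \<in> Bij (Atoms M)"
  using subgroup.subset[OF subgroup_G] by (auto simp: BijGroup_def)

lemma G_bij_betw: "\<pi> \<in> G \<Longrightarrow> bij_betw \<pi> (Atoms M) (Atoms M)"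
  using G_Bij by (simp add: Bij_def)

lemma G_image: "\<pi> \<in> G \<Longrightarrow> \<pi> ` Atoms M \<subseteq> Atoms M"
  using G_bij_betw by (simp add: bij_betw_def)

lemma lift_mult:
  assumes "\<pi> \<in> G" "\<sigma> \<in> G" "x \<in> Univ M"
  shows "lift_perm M (\<pi> \<otimes>\<^bsub>BijGroup (Atoms M)\<^esub> \<sigma>) x = lift_perm M \<pi> (lift_perm M \<sigma> x)"
proof -
  have "lift_perm M (\<pi> \<otimes>\<^bsub>BijGroup (Atoms M)\<^esub> \<sigma>) = lift_perm M (\<pi> \<circ> \<sigma>)"
    using assms G_Bij by (intro lift_cong) (simp add: BijGroup_def compose_def)
  then show ?thesis using assms by (simp add: lift_comp G_image)
qed

lemma lift_m_inv:
  assumes "\<pi> \<in> G" "x \<in> Univ M"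
  shows "lift_perm M (inv\<^bsub>BijGroup (Atoms M)\<^esub> \<pi>) (lift_perm M \<pi> x) = x"
    and "lift_perm M \<pi> (lift_perm M (inv\<^bsub>BijGroup (Atoms M)\<^esub> \<pi>) x) = x"
proof -
  have "lift_perm M (inv\<^bsub>BijGroup (Atoms M)\<^esub> \<pi>) = lift_perm M (inv_into (Atoms M) \<pi>)"
    using assms G_Bij by (intro lift_cong) (simp add: inv_BijGroup)
  then show "lift_perm M (inv\<^bsub>BijGroup (Atoms M)\<^esub> \<pi>) (lift_perm M \<pi> x) = x"
    "lift_perm M \<pi> (lift_perm M (inv\<^bsub>BijGroup (Atoms M)\<^esub> \<pi>) x) = x"
    using lift_inv_into[OF assms(2) G_bij_betw[OF assms(1)]] by simp_all
qed

lemma subgroup_sym_group: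
  assumes x: "x \<in> Univ M"
  shows "subgroup (sym_group M G x) (BijGroup (Atoms M))"
proof (rule group.subgroupI[OF group_BijGroup])
  interpret subgroup G "BijGroup (Atoms M)" by (rule subgroup_G)
  show "sym_group M G x \<subseteq> carrier (BijGroup (Atoms M))"
    using subset by (auto simp: sym_group_def)
  have "lift_perm M (\<one>\<^bsub>BijGroup (Atoms M)\<^esub>) x = x"
    using x by (intro lift_id) (simp_all add: BijGroup_def)
  then show "sym_group M G x \<noteq> {}"
    using one_closed unfolding sym_group_def by blast
  show "inv\<^bsub>BijGroup (Atoms M)\<^esub> \<pi> \<in> sym_group M G x" if "\<pi> \<in> sym_group M G x" for \<pi>
    using that lift_m_inv(1)[of \<pi> x] x by (simp add: sym_group_def)
  show "\<pi> \<otimes>\<^bsub>BijGroup (Atoms M)\<^esub> \<sigma> \<in> sym_group M G x"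
    if "\<pi> \<in> sym_group M G x" "\<sigma> \<in> sym_group M G x" for \<pi> \<sigma>
    using that x by (simp add: sym_group_def lift_mult)
qed

lemma sym_group_in_filterI:
  assumes "x \<in> Univ M" "H \<in> F" "\<And>\<pi>. \<pi> \<in> H \<Longrightarrow> lift_perm M \<pi> x = x"
  shows "sym_group M G x \<in> F"
  by (rule filter_upward[OF assms(2) subgroup_sym_group[OF assms(1)]])
    (use assms(3) filter_subset[OF assms(2)] in \<open>auto simp: sym_group_def\<close>)

lemma Univ_N: "Univ N = hered_sym M G F"
  by (simp add: N_def)

lemma in_N_iff: "x \<in> Univ N \<longleftrightarrow> x \<in> Univ M \<and> sym_group M G x \<in> F \<and> elts M x \<subseteq> Univ N"
  unfolding Univ_N by (subst hered_sym.simps) blast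

text \<open>Closure of \<open>X\<close> in one direction suffices: \<open>H\<close> is a group, and
  the inverse of \<open>\<pi>\<close> gives the other inclusion.\<close>

lemma coll_in_N:
  assumes "small M X" "X \<subseteq> Univ N" "H \<in> F"
    and "\<And>\<pi> x. \<pi> \<in> H \<Longrightarrow> x \<in> X \<Longrightarrow> lift_perm M \<pi> x \<in> X"
  shows "coll M X \<in> Univ N"
proof -
  have "lift_perm M \<pi> ` X = X" if "\<pi> \<in> H" for \<pi>
  proof
    show "lift_perm M \<pi> ` X \<subseteq> X" using assms(4) that by blast
    show "X \<subseteq> lift_perm M \<pi> ` X"
    proof
      fix x assume "x \<in> X"
      then have "lift_perm M (inv\<^bsub>BijGroup (Atoms M)\<^esub> \<pi>) x \<in> X"
        using assms(4) subgroup.m_inv_closed[OF filter_subgroup[OF assms(3)] that] by blast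
      moreover have "x \<in> Univ M" using \<open>x \<in> X\<close> assms(1) small_subset_Univ by blast
      ultimately show "x \<in> lift_perm M \<pi> ` X"
        using lift_m_inv(2)[of \<pi> x] filter_subset[OF assms(3)] that by (metis imageI subsetD)
    qed
  qed
  then have "sym_group M G (coll M X) \<in> F"
    using assms by (intro sym_group_in_filterI[of _ H]) (simp_all add: coll_in_Univ lift_coll)
  then show ?thesis
    using assms by (subst in_N_iff) (simp add: coll_in_Univ elts_coll)
qed

text \<open>Conjugating the symmetry group of \<open>x\<close> by \<open>\<pi>\<close> gives
  permutations that fix the image of \<open>x\<close>, and normality of the filter contains this
  conjugate. The members follow by induction.\<close>

lemma lift_in_N:
  assumes "x \<in> Univ N" "\<pi> \<in> G"
  shows "lift_perm M \<pi> x \<in> Univ N"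
  using assms(1) unfolding Univ_N
proof (induction rule: hered_sym.induct)
  case (1 x)
  let ?conj = "\<lambda>h. \<pi> \<otimes>\<^bsub>BijGroup (Atoms M)\<^esub> h \<otimes>\<^bsub>BijGroup (Atoms M)\<^esub> inv\<^bsub>BijGroup (Atoms M)\<^esub> \<pi>"
  interpret subgroup G "BijGroup (Atoms M)" by (rule subgroup_G)
  have Univ: "lift_perm M \<pi> x \<in> Univ M"
    using 1 assms(2) G_image by (simp add: lift_in_Univ)
  have "lift_perm M (?conj h) (lift_perm M \<pi> x) = lift_perm M \<pi> x" if "h \<in> sym_group M G x" for h
    using that assms(2) 1(1) Univ lift_m_inv(1)
    by (simp add: sym_group_def lift_mult)
  then have "sym_group M G (lift_perm M \<pi> x) \<in> F"
    by (intro sym_group_in_filterI[OF Univ filter_conj[OF assms(2) 1(2)]]) blast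
  moreover have "elts M (lift_perm M \<pi> x) \<subseteq> hered_sym M G F"
    using 1(4) elts_lift[OF 1(1) G_image[OF assms(2)]] by auto
  ultimately show ?case by (intro hered_sym.intros[OF Univ]) blast+
qed

lemma lift_image_N:
  assumes "\<pi> \<in> G" shows "lift_perm M \<pi> ` Univ N = Univ N"
proof
  interpret subgroup G "BijGroup (Atoms M)" by (rule subgroup_G)
  show "lift_perm M \<pi> ` Univ N \<subseteq> Univ N" using assms lift_in_N by blast
  show "Univ N \<subseteq> lift_perm M \<pi> ` Univ N"
    using assms lift_in_N[OF _ m_inv_closed[OF assms]] lift_m_inv(2)[OF assms] in_N_iff
    by (metis image_eqI subsetI)
qed

lemma finite_fixed_in_filter:
  assumes "finite X" "X \<subseteq> Univ N"
  shows "\<exists>H\<in>F. \<forall>\<pi>\<in>H. \<forall>x\<in>X. lift_perm M \<pi> x = x"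
  using assms
proof (induction rule: finite_induct)
  case empty
  then show ?case using G_in_filter by blast
next
  case (insert x X)
  then obtain H where "H \<in> F" "\<forall>\<pi>\<in>H. \<forall>x\<in>X. lift_perm M \<pi> x = x" by auto
  moreover have "sym_group M G x \<in> F" using insert.prems in_N_iff[of x] by simp
  ultimately show ?case
    by (intro bexI[of _ "H \<inter> sym_group M G x"] filter_Int) (simp_all add: sym_group_def)
qed

lemma coll_finite_in_N:
  assumes "finite X" "X \<subseteq> Univ N"
  shows "coll M X \<in> Univ N"
proof -
  obtain H where "H \<in> F" "\<forall>\<pi>\<in>H. \<forall>x\<in>X. lift_perm M \<pi> x = x"
    using finite_fixed_in_filter[OF assms] by blast
  moreover have "X \<subseteq> Univ M" using assms(2) in_N_iff by blast
  ultimately show ?thesis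
    using assms by (intro coll_in_N[of X H] small_finite) simp_all
qed

sublocale transitive_submodel M N
proof unfold_locales
  show "Mem N = Mem M" "Atoms N = Atoms M" by (simp_all add: N_def)
  show "Univ N \<subseteq> Univ M" using in_N_iff by blast
  show "elts M x \<subseteq> Univ N" if "x \<in> Univ N" for x using that in_N_iff by blast
  show "coll M {x, y} \<in> Univ N" if "x \<in> Univ N" "y \<in> Univ N" for x y
    using that by (intro coll_finite_in_N) auto
qed

lemma num_in_N: "num M n \<in> Univ N"
proof (induction n rule: less_induct)
  case (less n)
  have "sym_group M G (num M n) \<in> F"
    using G_in_filter by (intro sym_group_in_filterI) (auto simp: num_in_Univ lift_num G_image)
  then show ?case using less by (subst in_N_iff) (auto simp: num_in_Univ elts_num)
qed

lemma Atoms_subset_N: "Atoms M \<subseteq> Univ N"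
proof
  fix a assume a: "a \<in> Atoms M"
  then have "sym_group M G a = {\<pi>\<in>G. \<pi> a = a}" by (simp add: sym_group_def lift_atom)
  then show "a \<in> Univ N"
    using a stabilizer_in_filter[OF a] Atoms_subset_Univ by (subst in_N_iff) (auto simp: elts_atom)
qed

lemma small_N: "small M X \<Longrightarrow> coll M X \<in> Univ N \<Longrightarrow> small N X"
  using is_set_coll_N elts_coll_N unfolding small_def by blast

text \<open>Each set that an axiom asks for exists in \<open>M\<close>; what has to be checked is
  that some group in the filter leaves it invariant. Formulas matter only for separation and
  replacement.\<close>

lemma zfa_model_N: "zfa_model N"
  unfolding zfa_model_def zfa_axioms_def small_def[symmetric]
proof (intro conjI ballI allI impI)
  show "Atoms N \<subseteq> Univ N" using Atoms_subset_N by (simp add: Atoms_N)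
  show "elts N a = {}" if "a \<in> Atoms N" for a
    using that elts_atom Atoms_subset_N by (auto simp: Atoms_N elts_N)
  have "coll M (Atoms M) \<in> Univ N"
    using G_in_filter G_image
    by (intro coll_in_N[OF small_Atoms Atoms_subset_N, of G]) (auto simp: lift_atom)
  then show "small N (Atoms N)"
    using small_N[OF small_Atoms] by (simp add: Atoms_N)
  show "small N {}" using small_N[OF small_empty] coll_finite_in_N by simp
  show "x = y" if "is_set N x" "is_set N y" "elts N x = elts N y" for x y
    using that is_set_eqI by (simp add: is_set_N elts_N)
  show "small N {x, y}" if "x \<in> Univ N" "y \<in> Univ N" for x y
    using that in_Univ by (intro small_N small_pair pair_closed)
  have inv: "lift_perm M \<pi> z \<in> elts M x"
    if "x \<in> Univ N" "\<pi> \<in> sym_group M G x" "z \<in> elts M x" for \<pi> x z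
    using that elts_lift[of x \<pi>] in_Univ G_image by (auto simp: sym_group_def)
  show "small N (\<Union>y\<in>elts N x. elts N y)" if "is_set N x" for x
  proof -
    have x: "x \<in> Univ N" "is_set M x" using that by (auto simp: is_set_N)
    have e: "(\<Union>y\<in>elts N x. elts N y) = (\<Union>y\<in>elts M x. elts M y)"
      using x transitive[of x] by (intro SUP_cong) (simp_all add: elts_N subset_iff)
    have "lift_perm M \<pi> z \<in> (\<Union>y\<in>elts M x. elts M y)"
      if "\<pi> \<in> sym_group M G x" "z \<in> (\<Union>y\<in>elts M x. elts M y)" for \<pi> z
    proof -
      from that(2) obtain y where y: "y \<in> elts M x" "z \<in> elts M y" by blast
      have "\<pi> \<in> G" "y \<in> Univ M" "z \<in> Univ M" using that(1) y by (auto simp: sym_group_def elts_def)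
      then have "lift_perm M \<pi> z \<in> elts M (lift_perm M \<pi> y)"
        using y(2) G_image elts_lift by blast
      then show ?thesis using inv[OF x(1) that(1) y(1)] by blast
    qed
    moreover have "(\<Union>y\<in>elts M x. elts M y) \<subseteq> Univ N" using x(1) transitive by blast
    ultimately have "coll M (\<Union>y\<in>elts M x. elts M y) \<in> Univ N"
      using small_Union_elts[OF x(2)] x(1)[unfolded in_N_iff[of x]]
      by (intro coll_in_N[of _ "sym_group M G x"]) simp_all
    then show ?thesis unfolding e by (rule small_N[OF small_Union_elts[OF x(2)]])
  qed
  show "small N {y. is_set N y \<and> elts N y \<subseteq> elts N x}" if "is_set N x" for x
  proof -
    let ?P = "{y. is_set N y \<and> elts N y \<subseteq> elts N x}"
    have x: "x \<in> Univ N" "is_set M x" using that by (auto simp: is_set_N)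
    have s: "small M ?P"
      by (rule small_subset[OF small_Pow_elts[OF x(2)]]) (use x in \<open>auto simp: is_set_N elts_N\<close>)
    have "lift_perm M \<pi> y \<in> ?P" if "\<pi> \<in> sym_group M G x" "y \<in> ?P" for \<pi> y
    proof -
      have G: "\<pi> \<in> G" using that(1) by (simp add: sym_group_def)
      have y: "y \<in> Univ N" "is_set M y" "elts M y \<subseteq> elts M x"
        using that(2) x by (auto simp: is_set_N elts_N)
      have "elts M (lift_perm M \<pi> y) \<subseteq> elts M x"
        using inv[OF x(1) that(1)] y in_Univ G_image[OF G] by (auto simp: elts_lift)
      then show ?thesis
        using lift_in_N[OF y(1) G] is_set_lift[OF y(2) G_image[OF G]] x
        by (simp add: is_set_N elts_N)
    qed
    then have "coll M ?P \<in> Univ N"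
      using x in_N_iff by (intro coll_in_N[OF s, of "sym_group M G x"]) (auto simp: is_set_N)
    then show ?thesis by (rule small_N[OF s])
  qed
  show "\<exists>w. is_set N w \<and> (\<exists>z\<in>elts N w. is_set N z \<and> elts N z = {}) \<and>
        (\<forall>x\<in>elts N w. \<exists>s\<in>elts N w. is_set N s \<and> elts N s = insert x (elts N x))"
  proof -
    let ?w = "coll M (range (num M))"
    have w: "?w \<in> Univ N"
      using G_in_filter num_in_N G_image
      by (intro coll_in_N[OF small_range_num, of G]) (auto simp: lift_num)
    have e: "elts N ?w = range (num M)" using elts_coll_N[OF small_range_num w] .
    have n: "is_set N (num M n)" "elts N (num M n) = num M ` {..<n}" for n
      using num_in_N is_set_num by (simp_all add: is_set_N elts_N elts_num)
    have "\<exists>s\<in>range (num M). is_set N s \<and> elts N s = insert x (elts N x)" if "x \<in> range (num M)" for x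
    proof -
      from that obtain m where "x = num M m" by blast
      then show ?thesis
        by (intro bexI[of _ "num M (Suc m)"] conjI n(1)) (simp_all add: n(2) lessThan_Suc)
    qed
    then show ?thesis
      using n[of 0] is_set_coll_N[OF small_range_num w]
      by (intro exI[of _ ?w] conjI bexI[of _ "num M 0"]) (simp_all add: e)
  qed
  show "\<exists>y\<in>elts N x. elts N y \<inter> elts N x = {}" if "is_set N x" "elts N x \<noteq> {}" for x
  proof -
    have x: "x \<in> Univ N" "is_set M x" using that(1) by (auto simp: is_set_N)
    then have "elts M x \<noteq> {}" using that(2) by (simp add: elts_N)
    then obtain y where "y \<in> elts M x" "elts M y \<inter> elts M x = {}"
      using foundation[OF x(2)] by blast
    then show ?thesis using x transitive[of x] by (intro bexI[of _ y]) (simp_all add: elts_N subset_iff)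
  qed
  \<comment> \<open>\<open>H\<close> fixes the finitely many parameters that the formula can see, so
    the defined relation is invariant under \<open>H\<close>.\<close>
  have definable: "\<exists>H\<in>F. \<forall>\<pi>\<in>H. \<forall>x\<in>Univ N. \<forall>y\<in>Univ N.
      R (lift_perm M \<pi> x) (lift_perm M \<pi> y) \<longleftrightarrow> R x y" if R: "R \<in> definable_rels N" for R
  proof -
    obtain p e where e: "range e \<subseteq> Univ N" and R: "R = (\<lambda>x y. sat N p (e(0 := x, 1 := y)))"
      using R by (auto simp: definable_rels_def)
    obtain n where n: "\<And>e e'. \<forall>i<n. e i = e' i \<Longrightarrow> sat N p e = sat N p e'"
      using sat_depends_on_finitely_many by blast
    have "finite (e ` {..<n})" "e ` {..<n} \<subseteq> Univ N" using e by auto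
    from finite_fixed_in_filter[OF this] obtain H
      where H: "H \<in> F" "\<forall>\<pi>\<in>H. \<forall>x\<in>e ` {..<n}. lift_perm M \<pi> x = x" by blast
    have "R (lift_perm M \<pi> x) (lift_perm M \<pi> y) \<longleftrightarrow> R x y"
      if "\<pi> \<in> H" "x \<in> Univ N" "y \<in> Univ N" for \<pi> x y
    proof -
      have G: "\<pi> \<in> G" using that(1) H(1) filter_subset by blast
      let ?e = "e(0 := x, 1 := y)"
      \<comment> \<open>The two environments need to agree only below \<open>n\<close>: there the
        parameters are fixed by \<open>\<pi>\<close>, while variables 0 and 1 carry the images on
        both sides.\<close>
      have "R (lift_perm M \<pi> x) (lift_perm M \<pi> y) \<longleftrightarrow> sat N p (lift_perm M \<pi> \<circ> ?e)"
        unfolding R by (rule n) (use H(2) that(1) in simp)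
      also have "\<dots> \<longleftrightarrow> sat N p ?e"
        using e that by (intro sat_lift G_bij_betw[OF G] lift_image_N[OF G])
          (auto simp: Mem_N Atoms_N in_Univ)
      finally show ?thesis by (simp add: R)
    qed
    then show ?thesis using H(1) by blast
  qed
  show "small N {y \<in> elts N x. R y c}"
    if R: "R \<in> definable_rels N" and "is_set N x" "c \<in> Univ N" for R x c
  proof -
    let ?P = "{y \<in> elts N x. R y c}"
    have x: "x \<in> Univ N" "is_set M x" using \<open>is_set N x\<close> by (auto simp: is_set_N)
    obtain H where H: "H \<in> F" "\<forall>\<pi>\<in>H. \<forall>x\<in>Univ N. \<forall>y\<in>Univ N.
        R (lift_perm M \<pi> x) (lift_perm M \<pi> y) \<longleftrightarrow> R x y"
      using definable[OF R] by blast
    have s: "small M ?P" using separation[OF x(2)] x(1) by (simp add: elts_N)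
    let ?H = "H \<inter> (sym_group M G x \<inter> sym_group M G c)"
    have "?H \<in> F" using H(1) x(1) \<open>c \<in> Univ N\<close> in_N_iff[of x] in_N_iff[of c]
      by (intro filter_Int) simp_all
    moreover have "lift_perm M \<pi> y \<in> ?P" if "\<pi> \<in> ?H" "y \<in> ?P" for \<pi> y
    proof -
      have y: "y \<in> elts M x" "y \<in> Univ N" "R y c"
        using that(2) x transitive by (auto simp: elts_N)
      have "R (lift_perm M \<pi> y) (lift_perm M \<pi> c)"
        using H(2) that(1) y \<open>c \<in> Univ N\<close> by blast
      moreover have "lift_perm M \<pi> c = c" using that(1) by (simp add: sym_group_def)
      moreover have "lift_perm M \<pi> y \<in> elts M x" using inv[OF x(1) _ y(1)] that(1) by blast
      ultimately show ?thesis using x(1) by (simp add: elts_N)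
    qed
    moreover have "?P \<subseteq> Univ N" by (auto simp: elts_def)
    ultimately have "coll M ?P \<in> Univ N" by (intro coll_in_N[OF s])
    then show ?thesis by (rule small_N[OF s])
  qed
  show "small N {y \<in> Univ N. \<exists>t\<in>elts N x. R t y}"
    if R: "R \<in> definable_rels N" and "is_set N x"
      and func: "\<forall>t\<in>elts N x. \<forall>y\<in>Univ N. \<forall>y'\<in>Univ N. R t y \<longrightarrow> R t y' \<longrightarrow> y = y'" for R x
  proof -
    let ?P = "{y \<in> Univ N. \<exists>t\<in>elts N x. R t y}"
    have x: "x \<in> Univ N" "is_set M x" using \<open>is_set N x\<close> by (auto simp: is_set_N)
    obtain H where H: "H \<in> F" "\<forall>\<pi>\<in>H. \<forall>x\<in>Univ N. \<forall>y\<in>Univ N.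
        R (lift_perm M \<pi> x) (lift_perm M \<pi> y) \<longleftrightarrow> R x y"
      using definable[OF R] by blast
    \<comment> \<open>Functionality is known only for values in the model, so replacement in
      \<open>M\<close> is applied to \<open>R\<close> restricted to such values.\<close>
    have "small M {y \<in> Univ M. \<exists>t\<in>elts M x. y \<in> Univ N \<and> R t y}"
      using func x(1) by (intro replacement[OF x(2)]) (simp add: elts_N)
    moreover have "{y \<in> Univ M. \<exists>t\<in>elts M x. y \<in> Univ N \<and> R t y} = ?P"
      using x(1) in_Univ by (auto simp: elts_N)
    ultimately have s: "small M ?P" by simp
    let ?H = "H \<inter> sym_group M G x"
    have "?H \<in> F" using H(1) x(1) in_N_iff by (intro filter_Int) simp_all
    moreover have "lift_perm M \<pi> y \<in> ?P" if "\<pi> \<in> ?H" "y \<in> ?P" for \<pi> y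
    proof -
      from that(2) obtain t where t: "t \<in> elts M x" "t \<in> Univ N" "y \<in> Univ N" "R t y"
        using x transitive by (auto simp: elts_N)
      have "R (lift_perm M \<pi> t) (lift_perm M \<pi> y)" using H(2) that(1) t by blast
      moreover have "lift_perm M \<pi> t \<in> elts M x" using inv[OF x(1) _ t(1)] that(1) by blast
      moreover have "lift_perm M \<pi> y \<in> Univ N"
        using lift_in_N[OF t(3)] that(1) by (simp add: sym_group_def)
      ultimately show ?thesis using x(1) by (auto simp: elts_N)
    qed
    moreover have "?P \<subseteq> Univ N" by blast
    ultimately have "coll M ?P \<in> Univ N" by (intro coll_in_N[OF s])
    then show ?thesis by (rule small_N[OF s])
  qed
qed

end


section \<open>The basic Fraenkel model\<close>

text \<open>Nothing is required outside \<open>A\<close>, unlike in \<open>Bij\<close>, so ordinary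
  composition and transpositions can be used directly; intersecting with \<open>Bij A\<close> gives
  the group elements.\<close>

definition fixing :: "'a set \<Rightarrow> 'a set \<Rightarrow> ('a \<Rightarrow> 'a) set" where
  "fixing A E = {\<pi>. bij_betw \<pi> A A \<and> (\<forall>a\<in>E. \<pi> a = a)}"

definition finite_support_filter :: "'a set \<Rightarrow> ('a \<Rightarrow> 'a) set set" where
  "finite_support_filter A = {H. subgroup H (BijGroup A) \<and>
     (\<exists>E\<subseteq>A. finite E \<and> fixing A E \<inter> Bij A \<subseteq> H)}"

lemma carrier_BijGroup: "carrier (BijGroup A) = Bij A"
  by (simp add: BijGroup_def)

section \<open>The filter of finite supports is normal\<close>

lemma Bij_apply_in: "\<pi> \<in> Bij A \<Longrightarrow> a \<in> A \<Longrightarrow> \<pi> a \<in> A"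
  using Bij_imp_funcset by blast

lemma BijGroup_mult_apply:
  "\<pi> \<in> Bij A \<Longrightarrow> \<sigma> \<in> Bij A \<Longrightarrow> a \<in> A \<Longrightarrow> (\<pi> \<otimes>\<^bsub>BijGroup A\<^esub> \<sigma>) a = \<pi> (\<sigma> a)"
  by (simp add: BijGroup_def compose_def)

lemma BijGroup_inv_apply:
  assumes "\<pi> \<in> Bij A" "a \<in> A"
  shows "(inv\<^bsub>BijGroup A\<^esub> \<pi>) (\<pi> a) = a"
  using assms Bij_apply_in[OF assms] bij_betw_inv_into_left[of \<pi> A A a]
  by (simp add: inv_BijGroup Bij_def)

lemma subgroup_fixing:
  assumes "E \<subseteq> A"
  shows "subgroup (fixing A E \<inter> Bij A) (BijGroup A)"
proof -
  interpret group "BijGroup A" by (rule group_BijGroup)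
  have mem: "\<pi> \<in> fixing A E \<inter> Bij A \<longleftrightarrow> \<pi> \<in> Bij A \<and> (\<forall>a\<in>E. \<pi> a = a)" for \<pi>
    by (auto simp: fixing_def Bij_def)
  show ?thesis
  proof (rule subgroupI)
    show "fixing A E \<inter> Bij A \<subseteq> carrier (BijGroup A)" by (simp add: carrier_BijGroup)
    have "\<one>\<^bsub>BijGroup A\<^esub> \<in> fixing A E \<inter> Bij A"
      using one_closed assms unfolding mem by (auto simp: carrier_BijGroup BijGroup_def)
    then show "fixing A E \<inter> Bij A \<noteq> {}" by blast
    show "inv\<^bsub>BijGroup A\<^esub> \<pi> \<in> fixing A E \<inter> Bij A" if "\<pi> \<in> fixing A E \<inter> Bij A" for \<pi>
      using that inv_closed[of \<pi>] BijGroup_inv_apply[of \<pi> A] assms unfolding mem carrier_BijGroup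
      by (metis subsetD)
    show "\<pi> \<otimes>\<^bsub>BijGroup A\<^esub> \<sigma> \<in> fixing A E \<inter> Bij A"
      if "\<pi> \<in> fixing A E \<inter> Bij A" "\<sigma> \<in> fixing A E \<inter> Bij A" for \<pi> \<sigma>
      using that m_closed[of \<pi> \<sigma>] BijGroup_mult_apply[of \<pi> A \<sigma>] assms
      unfolding mem carrier_BijGroup by (metis subsetD)
  qed
qed

lemma subgroup_conjugate:
  assumes "\<pi> \<in> Bij A" "subgroup H (BijGroup A)"
  shows "subgroup ((\<lambda>h. \<pi> \<otimes>\<^bsub>BijGroup A\<^esub> h \<otimes>\<^bsub>BijGroup A\<^esub> inv\<^bsub>BijGroup A\<^esub> \<pi>) ` H) (BijGroup A)"
proof -
  interpret group "BijGroup A" by (rule group_BijGroup)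
  have \<pi>: "\<pi> \<in> carrier (BijGroup A)" using assms(1) by (simp add: carrier_BijGroup)
  have "(\<lambda>h. \<pi> \<otimes>\<^bsub>BijGroup A\<^esub> h \<otimes>\<^bsub>BijGroup A\<^esub> inv\<^bsub>BijGroup A\<^esub> \<pi>) ` H =
      inv\<^bsub>BijGroup A\<^esub> (inv\<^bsub>BijGroup A\<^esub> \<pi>) <#\<^bsub>BijGroup A\<^esub> H #>\<^bsub>BijGroup A\<^esub> inv\<^bsub>BijGroup A\<^esub> \<pi>"
    using \<pi> by (auto simp: l_coset_def r_coset_def)
  then show ?thesis
    using subgroup_conjugation_is_surj1[OF inv_closed[OF \<pi>] assms(2)] by simp
qed

lemma normal_filter_finite_support: "normal_filter A (Bij A) (finite_support_filter A)"
proof -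
  interpret group "BijGroup A" by (rule group_BijGroup)
  have memI: "H \<in> finite_support_filter A"
    if "subgroup H (BijGroup A)" "E \<subseteq> A" "finite E" "fixing A E \<inter> Bij A \<subseteq> H" for H E
    using that by (auto simp: finite_support_filter_def)
  have memE: "\<exists>E\<subseteq>A. finite E \<and> fixing A E \<inter> Bij A \<subseteq> H" if "H \<in> finite_support_filter A" for H
    using that by (simp add: finite_support_filter_def)
  have sub: "subgroup H (BijGroup A)" if "H \<in> finite_support_filter A" for H
    using that by (simp add: finite_support_filter_def)
  have sub_Bij: "H \<subseteq> Bij A" if "H \<in> finite_support_filter A" for H
    using subgroup.subset[OF sub[OF that]] by (simp add: carrier_BijGroup)
  show ?thesis
    unfolding normal_filter_def
  proof (intro conjI ballI allI impI)
    show "subgroup H (BijGroup A)" if "H \<in> finite_support_filter A" for H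
      using that by (rule sub)
    show "H \<subseteq> Bij A" if "H \<in> finite_support_filter A" for H
      using that by (rule sub_Bij)
    show "Bij A \<in> finite_support_filter A"
      using subgroup_self by (intro memI[of _ "{}"]) (simp_all add: carrier_BijGroup)
    show "K \<in> finite_support_filter A"
      if "H \<in> finite_support_filter A" "subgroup K (BijGroup A)" "H \<subseteq> K" for H K
      using that memE[of H] memI[of K] by (meson subset_trans)
    show "H \<inter> K \<in> finite_support_filter A"
      if HK: "H \<in> finite_support_filter A" "K \<in> finite_support_filter A" for H K
    proof -
      obtain E D where ED: "E \<subseteq> A" "finite E" "fixing A E \<inter> Bij A \<subseteq> H"
        "D \<subseteq> A" "finite D" "fixing A D \<inter> Bij A \<subseteq> K"
        using memE[OF HK(1)] memE[OF HK(2)] by blast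
      have "fixing A (E \<union> D) \<inter> Bij A \<subseteq> H \<inter> K"
        using ED(3,6) by (auto simp: fixing_def)
      then show ?thesis
        using ED HK sub subgroups_Inter_pair by (intro memI[of _ "E \<union> D"]) simp_all
    qed
    show "(\<lambda>h. \<pi> \<otimes>\<^bsub>BijGroup A\<^esub> h \<otimes>\<^bsub>BijGroup A\<^esub> inv\<^bsub>BijGroup A\<^esub> \<pi>) ` H \<in> finite_support_filter A"
      (is "?conj ` H \<in> _") if \<pi>: "\<pi> \<in> Bij A" and H: "H \<in> finite_support_filter A" for \<pi> H
    proof -
      obtain E where E: "E \<subseteq> A" "finite E" "fixing A E \<inter> Bij A \<subseteq> H"
        using memE[OF H] by blast
      \<comment> \<open>The conjugate of \<open>H\<close> is supported by the image of
        \<open>E\<close>: if \<open>\<sigma>\<close> fixes \<open>\<pi> a\<close> for all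
        \<open>a\<close> in \<open>E\<close>, then conjugating \<open>\<sigma>\<close> back gives a
        permutation \<open>?h\<close> that fixes \<open>E\<close> and thus lies in
        \<open>H\<close>.\<close>
      have "\<sigma> \<in> ?conj ` H" if "\<sigma> \<in> fixing A (\<pi> ` E) \<inter> Bij A" for \<sigma>
      proof -
        let ?inv = "inv\<^bsub>BijGroup A\<^esub> \<pi>"
        let ?h = "?inv \<otimes>\<^bsub>BijGroup A\<^esub> (\<sigma> \<otimes>\<^bsub>BijGroup A\<^esub> \<pi>)"
        have \<sigma>: "\<sigma> \<in> Bij A" using that by simp
        have inv: "?inv \<in> Bij A" and \<sigma>\<pi>: "\<sigma> \<otimes>\<^bsub>BijGroup A\<^esub> \<pi> \<in> Bij A" and h: "?h \<in> Bij A"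
          using \<pi> \<sigma> inv_closed m_closed by (simp_all add: carrier_BijGroup)
        have "?h a = a" if "a \<in> E" for a
        proof -
          have a: "a \<in> A" using that E(1) by blast
          have "\<sigma> (\<pi> a) = \<pi> a" using that \<open>\<sigma> \<in> fixing A (\<pi> ` E) \<inter> Bij A\<close> by (simp add: fixing_def)
          then show ?thesis
            using a \<pi> \<sigma> inv \<sigma>\<pi> by (simp add: BijGroup_mult_apply BijGroup_inv_apply)
        qed
        then have "?h \<in> H" using h E(3) by (auto simp: fixing_def Bij_def)
        moreover have "\<sigma> = ?conj ?h"
        proof -
          note carrier = \<pi>[folded carrier_BijGroup] \<sigma>[folded carrier_BijGroup]
          have "\<pi> \<otimes>\<^bsub>BijGroup A\<^esub> ?h = \<sigma> \<otimes>\<^bsub>BijGroup A\<^esub> \<pi>"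
            using carrier by (simp add: m_assoc[symmetric])
          then show ?thesis using carrier by (simp add: m_assoc)
        qed
        ultimately show ?thesis by (intro image_eqI[of _ _ ?h])
      qed
      then show ?thesis
        using E Bij_apply_in[OF \<pi>]
        by (intro memI[of _ "\<pi> ` E"] subgroup_conjugate[OF \<pi> sub[OF H]]) auto
    qed
    show "{\<pi> \<in> Bij A. \<pi> a = a} \<in> finite_support_filter A" if "a \<in> A" for a
    proof -
      have "{\<pi> \<in> Bij A. \<pi> a = a} = fixing A {a} \<inter> Bij A"
        by (auto simp: fixing_def Bij_def)
      then show ?thesis
        using that subgroup_fixing[of "{a}" A] by (intro memI[of _ "{a}"]) auto
    qed
  qed
qed

section \<open>Approximation by finite permutations\<close>

lemma permutes_fixing: "\<rho> permutes X \<Longrightarrow> X \<subseteq> A - E \<Longrightarrow> \<rho> \<in> fixing A E"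
  using permutes_imp_bij[OF permutes_subset, of \<rho> X A] permutes_not_in[of \<rho> X]
  by (auto simp: fixing_def)

lemma transpose_fixing:
  "a \<in> A - E \<Longrightarrow> b \<in> A - E \<Longrightarrow> Transposition.transpose a b \<in> fixing A E"
  by (rule permutes_fixing[OF permutes_swap_id[of a "{a, b}" b]]) auto

text \<open>Points of \<open>S\<close> are added one at a time, and a wrong value at the new point
  is corrected by a transposition. Moving only finitely many points makes finite order and
  factorization into transpositions available.\<close>

lemma finite_permutation_agreeing:
  assumes "\<pi> \<in> fixing A E" "finite S" "S \<subseteq> A"
  shows "\<exists>\<rho> X. finite X \<and> X \<subseteq> A - E \<and> \<rho> permutes X \<and> (\<forall>s\<in>S. \<rho> s = \<pi> s)"
  using assms(2,3)
proof (induction S rule: finite_induct)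
  case empty
  show ?case by (intro exI[of _ id] exI[of _ "{}"] conjI permutes_id) simp_all
next
  case (insert a S)
  then obtain \<rho> X where \<rho>: "finite X" "X \<subseteq> A - E" "\<rho> permutes X" "\<forall>s\<in>S. \<rho> s = \<pi> s"
    by auto
  have \<rho>A: "\<rho> \<in> fixing A E" using \<rho> permutes_fixing by blast
  show ?case
  proof (cases "\<rho> a = \<pi> a")
    case True
    then show ?thesis using \<rho> by blast
  next
    case False
    have a: "a \<in> A" "a \<notin> E" using insert.prems False assms(1) \<rho>A by (auto simp: fixing_def)
    \<comment> \<open>By injectivity nothing outside \<open>E\<close> can be sent to a fixed point
      in \<open>E\<close>, so the correcting transposition avoids \<open>E\<close>.\<close>
    have out: "\<tau> a \<in> A - E" if "\<tau> \<in> fixing A E" for \<tau>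
    proof
      have bij: "bij_betw \<tau> A A" using that by (simp add: fixing_def)
      show "\<tau> a \<in> A" using bij a(1) by (rule bij_betw_apply)
      show "\<tau> a \<notin> E"
      proof
        assume e: "\<tau> a \<in> E"
        then have "\<tau> (\<tau> a) = \<tau> a" using that by (simp add: fixing_def)
        then have "\<tau> a = a"
          using bij_betw_imp_inj_on[OF bij] \<open>\<tau> a \<in> A\<close> a(1) by (simp add: inj_on_eq_iff)
        then show False using e a(2) by simp
      qed
    qed
    \<comment> \<open>Earlier values survive: for \<open>s\<close> in \<open>S\<close> the common
      value of \<open>\<rho>\<close> and \<open>\<pi>\<close> differs from both
      \<open>\<rho> a\<close> and \<open>\<pi> a\<close>, because both maps are injective.\<close>
    define \<rho>' where "\<rho>' = Transposition.transpose (\<rho> a) (\<pi> a) \<circ> \<rho>"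
    let ?Y = "X \<union> {\<rho> a, \<pi> a}"
    have perm: "\<rho>' permutes ?Y" unfolding \<rho>'_def
      by (intro permutes_compose permutes_swap_id permutes_subset[OF \<rho>(3)]) auto
    have Y: "finite ?Y" "?Y \<subseteq> A - E" using \<rho>(1,2) out[OF \<rho>A] out[OF assms(1)] by auto
    have agree: "\<forall>s\<in>insert a S. \<rho>' s = \<pi> s"
    proof
      fix s assume that: "s \<in> insert a S"
      show "\<rho>' s = \<pi> s"
      proof (cases "s = a")
        case True
        then show ?thesis by (simp add: \<rho>'_def)
      next
        case False
        then have s: "s \<in> S" "s \<in> A" using that insert.prems by auto
        have "\<pi> s \<noteq> \<pi> a"
          using assms(1) a(1) s False by (auto simp: fixing_def bij_betw_def inj_on_def)
        moreover have "\<rho> s \<noteq> \<rho> a"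
          using \<rho>A a(1) s False by (auto simp: fixing_def bij_betw_def inj_on_def)
        ultimately show ?thesis using s \<rho>(4) by (simp add: \<rho>'_def)
      qed
    qed
    show ?thesis by (intro exI[of _ \<rho>'] exI[of _ ?Y] conjI perm Y agree)
  qed
qed

locale fraenkel = zfa_universe +
  assumes infinite_Atoms: "infinite (Atoms M)"
begin

sublocale permutation_submodel M "Bij (Atoms M)" "finite_support_filter (Atoms M)"
proof (intro permutation_submodel.intro permutation_submodel_axioms.intro)
  show "zfa_universe M" by (rule zfa_universe_axioms)
  show "subgroup (Bij (Atoms M)) (BijGroup (Atoms M))"
    by (rule group.subgroup_self[OF group_BijGroup, unfolded carrier_BijGroup])
  show "normal_filter (Atoms M) (Bij (Atoms M)) (finite_support_filter (Atoms M))"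
    by (rule normal_filter_finite_support)
qed

section \<open>Finite supports\<close>

abbreviation "Fix \<equiv> fixing (Atoms M)"

definition supports :: "'a set \<Rightarrow> 'a \<Rightarrow> bool" where
  "supports E x \<longleftrightarrow> (\<forall>\<pi>\<in>Fix E. lift_perm M \<pi> x = x)"

lemma Fix_image: "\<pi> \<in> Fix E \<Longrightarrow> \<pi> ` Atoms M \<subseteq> Atoms M"
  by (simp add: fixing_def bij_betw_def)

lemma Fix_bij: "\<pi> \<in> Fix E \<Longrightarrow> bij_betw \<pi> (Atoms M) (Atoms M)"
  by (simp add: fixing_def)

lemma restrict_Fix: "\<pi> \<in> Fix E \<Longrightarrow> E \<subseteq> Atoms M \<Longrightarrow> restrict \<pi> (Atoms M) \<in> Fix E \<inter> Bij (Atoms M)"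
  by (auto simp: fixing_def Bij_def cong: bij_betw_cong)

lemma lift_restrict: "lift_perm M (restrict \<pi> (Atoms M)) = lift_perm M \<pi>"
  by (rule lift_cong) simp

lemma lift_in_N_bij:
  assumes "x \<in> Univ N" "\<pi> \<in> Fix {}"
  shows "lift_perm M \<pi> x \<in> Univ N"
  using lift_in_N[OF assms(1), of "restrict \<pi> (Atoms M)"] restrict_Fix[OF assms(2)]
  by (simp add: lift_restrict)

lemma Fix_antimono: "E \<subseteq> D \<Longrightarrow> Fix D \<subseteq> Fix E"
  by (auto simp: fixing_def)

lemma Fix_comp: "\<pi> \<in> Fix E \<Longrightarrow> \<sigma> \<in> Fix E \<Longrightarrow> \<pi> \<circ> \<sigma> \<in> Fix E"
  by (auto simp: fixing_def intro: bij_betw_trans)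

lemma Fix_inv_into:
  assumes "\<pi> \<in> Fix E" "E \<subseteq> Atoms M"
  shows "inv_into (Atoms M) \<pi> \<in> Fix E"
proof -
  have b: "bij_betw \<pi> (Atoms M) (Atoms M)" using assms(1) by (rule Fix_bij)
  have "inv_into (Atoms M) \<pi> a = a" if "a \<in> E" for a
    using that assms bij_betw_inv_into_left[OF b, of a] by (auto simp: fixing_def)
  then show ?thesis using bij_betw_inv_into[OF b] by (simp add: fixing_def)
qed

lemma supports_mono: "supports E x \<Longrightarrow> E \<subseteq> D \<Longrightarrow> supports D x"
  using Fix_antimono unfolding supports_def by blast

lemma finite_support_exists:
  assumes "x \<in> Univ N"
  obtains E where "E \<subseteq> Atoms M" "finite E" "supports E x"
proof -
  have "sym_group M (Bij (Atoms M)) x \<in> finite_support_filter (Atoms M)"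
    using assms in_N_iff by blast
  then obtain E where E: "E \<subseteq> Atoms M" "finite E"
    "Fix E \<inter> Bij (Atoms M) \<subseteq> sym_group M (Bij (Atoms M)) x"
    by (auto simp: finite_support_filter_def)
  have "lift_perm M \<pi> x = x" if "\<pi> \<in> Fix E" for \<pi>
    using restrict_Fix[OF that E(1)] E(3) by (auto simp: sym_group_def lift_restrict)
  with E that show thesis by (auto simp: supports_def)
qed

lemma coll_in_N_Fix:
  assumes "small M X" "X \<subseteq> Univ N" "E \<subseteq> Atoms M" "finite E"
    and "\<And>\<pi> x. \<pi> \<in> Fix E \<Longrightarrow> x \<in> X \<Longrightarrow> lift_perm M \<pi> x \<in> X"
  shows "coll M X \<in> Univ N"
proof (rule coll_in_N[OF assms(1,2)])
  show "Fix E \<inter> Bij (Atoms M) \<in> finite_support_filter (Atoms M)"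
    using assms(3,4) subgroup_fixing by (auto simp: finite_support_filter_def)
qed (use assms(5) in blast)

text \<open>The inverse of \<open>\<rho>\<close> after \<open>\<pi>\<close> fixes \<open>S\<close>
  pointwise, hence fixes \<open>x\<close>.\<close>

lemma lift_eq_if_agree_on_support:
  assumes "x \<in> Univ M" "supports S x" "\<pi> \<in> Fix {}" "\<rho> \<in> Fix {}" "S \<subseteq> Atoms M"
    and "\<And>s. s \<in> S \<Longrightarrow> \<rho> s = \<pi> s"
  shows "lift_perm M \<rho> x = lift_perm M \<pi> x"
proof -
  let ?i = "inv_into (Atoms M) \<rho>"
  have b: "bij_betw \<rho> (Atoms M) (Atoms M)" using assms(4) by (rule Fix_bij)
  have i: "?i \<in> Fix {}" using assms(4) by (rule Fix_inv_into) simp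
  have "(?i \<circ> \<pi>) s = s" if "s \<in> S" for s
    using bij_betw_inv_into_left[OF b, of s] assms(5,6) that by auto
  then have "?i \<circ> \<pi> \<in> Fix S"
    using Fix_comp[OF i assms(3)] by (simp add: fixing_def)
  then have "lift_perm M (?i \<circ> \<pi>) x = x" using assms(2) by (simp add: supports_def)
  then have "lift_perm M ?i (lift_perm M \<pi> x) = x"
    using lift_comp[OF assms(1) Fix_image[OF i] Fix_image[OF assms(3)]] by simp
  then show ?thesis
    using lift_inv_into(2)[OF lift_in_Univ[OF assms(1) Fix_image[OF assms(3)]] b] by simp
qed

lemma agreeing_finite_permutation:
  assumes "x \<in> Univ N" "\<pi> \<in> Fix E"
  obtains \<rho> X where "finite X" "X \<subseteq> Atoms M - E" "\<rho> permutes X" "lift_perm M \<rho> x = lift_perm M \<pi> x"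
proof -
  obtain S where S: "S \<subseteq> Atoms M" "finite S" "supports S x"
    using finite_support_exists[OF assms(1)] .
  obtain \<rho> X where \<rho>: "finite X" "X \<subseteq> Atoms M - E" "\<rho> permutes X" "\<forall>s\<in>S. \<rho> s = \<pi> s"
    using finite_permutation_agreeing[OF assms(2) S(2,1)] by blast
  have "\<pi> \<in> Fix {}" "\<rho> \<in> Fix {}"
    using assms(2) permutes_fixing[OF \<rho>(3,2)] Fix_antimono[of "{}" E] by auto
  then have "lift_perm M \<rho> x = lift_perm M \<pi> x"
    using \<rho>(4) S in_Univ[OF assms(1)] by (intro lift_eq_if_agree_on_support[of _ S]) simp_all
  with \<rho> that show thesis by blast
qed

text \<open>On a single element of the model every permutation fixing \<open>E\<close> acts like one
  that moves finitely many atoms, all outside \<open>E\<close>, and this is a product of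
  transpositions of such atoms.\<close>

lemma supports_if_transpositions_fix:
  assumes x: "x \<in> Univ N"
    and transp: "\<And>a b. a \<in> Atoms M - E \<Longrightarrow> b \<in> Atoms M - E \<Longrightarrow>
      lift_perm M (Transposition.transpose a b) x = x"
  shows "supports E x"
  unfolding supports_def
proof
  fix \<pi> assume "\<pi> \<in> Fix E"
  then obtain \<rho> X where \<rho>: "finite X" "X \<subseteq> Atoms M - E" "\<rho> permutes X"
    "lift_perm M \<rho> x = lift_perm M \<pi> x"
    by (rule agreeing_finite_permutation[OF x])
  have "lift_perm M \<rho> x = x" using \<rho>(3,1)
  proof (induction rule: permutes_induct)
    case id
    then show ?case using in_Univ[OF x] by (simp add: lift_id)
  next
    case (swap a b p)
    have ab: "a \<in> Atoms M - E" "b \<in> Atoms M - E" using swap \<rho>(2) by auto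
    have "lift_perm M (Transposition.transpose a b \<circ> p) x =
        lift_perm M (Transposition.transpose a b) (lift_perm M p x)"
      using Fix_image[OF transpose_fixing[OF ab]] Fix_image[OF permutes_fixing[OF \<open>p permutes X\<close> \<rho>(2)]]
      by (simp add: lift_comp in_Univ[OF x])
    then show ?case by (simp only: transp[OF ab] swap)
  qed
  then show "lift_perm M \<pi> x = x" using \<rho>(4) by simp
qed

text \<open>For atoms \<open>a\<close>, \<open>c\<close> outside \<open>E\<close> with \<open>c\<close> also outside \<open>D\<close>, and a fresh atom \<open>d\<close>, the
  transposition \<open>(c d)\<close> fixes the element \<open>(a d) x\<close> of the orbit; conjugating by \<open>(a d)\<close> shows that
  \<open>(a c)\<close> fixes \<open>x\<close>.\<close>

lemma supports_if_orbit_supported: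
  assumes x: "x \<in> Univ N" and ED: "finite E" "finite D"
    and orbit: "\<And>\<pi>. \<pi> \<in> Fix E \<Longrightarrow> supports D (lift_perm M \<pi> x)"
  shows "supports E x"
proof (rule supports_if_transpositions_fix[OF x])
  let ?t = "\<lambda>a b. lift_perm M (Transposition.transpose a b)"
  have fresh: "\<exists>d\<in>Atoms M - E. d \<notin> D \<and> d \<notin> B" if "finite B" for B
  proof -
    have "infinite (Atoms M - (E \<union> D \<union> B))" using infinite_Atoms ED that by simp
    then obtain d where "d \<in> Atoms M - (E \<union> D \<union> B)" using infinite_imp_nonempty by blast
    then show ?thesis by blast
  qed
  have xM: "x \<in> Univ M" using x by (rule in_Univ)
  have conj: "?t a d (?t c d (?t a d x)) = ?t a c x"
    if "a \<in> Atoms M" "c \<in> Atoms M" "d \<in> Atoms M" "a \<noteq> c" "a \<noteq> d" "c \<noteq> d" for a c d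
  proof -
    have im: "Transposition.transpose a b ` Atoms M \<subseteq> Atoms M" if "a \<in> Atoms M" "b \<in> Atoms M" for a b
      using that Fix_image[OF transpose_fixing[of a _ "{}"]] by simp
    have "Transposition.transpose a d \<circ> (Transposition.transpose c d \<circ> Transposition.transpose a d) =
        Transposition.transpose a c"
      using that by (auto simp: fun_eq_iff Transposition.transpose_def)
    moreover have "(Transposition.transpose c d \<circ> Transposition.transpose a d) ` Atoms M \<subseteq> Atoms M"
      using im[OF that(2,3)] im[OF that(1,3)] by (simp add: image_comp[symmetric]) blast
    ultimately show ?thesis using that xM by (simp only: lift_comp im)
  qed
  have step: "?t a c x = x" if "a \<in> Atoms M - E" "c \<in> Atoms M - E" "c \<notin> D" "a \<noteq> c" for a c
  proof -
    obtain d where d: "d \<in> Atoms M - E" "d \<notin> D" "d \<notin> {a, c}" using fresh[of "{a, c}"] by blast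
    have "supports D (?t a d x)" by (rule orbit[OF transpose_fixing[OF that(1) d(1)]])
    moreover have "Transposition.transpose c d \<in> Fix D"
      using that d by (intro transpose_fixing) auto
    ultimately have "?t c d (?t a d x) = ?t a d x" by (simp add: supports_def)
    then have "?t a c x = ?t a d (?t a d x)" using conj[of a c d] that d by auto
    also have "\<dots> = x"
      using Fix_image[OF transpose_fixing[of a _ "{}" d]] that d xM by (simp add: lift_comp lift_id)
    finally show ?thesis .
  qed
  fix a b assume ab: "a \<in> Atoms M - E" "b \<in> Atoms M - E"
  show "?t a b x = x"
  proof (cases "a = b")
    case True
    then show ?thesis using xM by (simp add: lift_id)
  next
    case False
    \<comment> \<open>Both \<open>a\<close> and \<open>b\<close> may lie in \<open>D\<close>, so
      \<open>step\<close> need not apply to them. Writing \<open>(a b)\<close> as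
      \<open>(a c) (b c) (a c)\<close> with \<open>c\<close> outside \<open>D\<close> leaves only
      factors covered by \<open>step\<close>.\<close>
    obtain c where c: "c \<in> Atoms M - E" "c \<notin> D" "c \<notin> {a, b}" using fresh[of "{a, b}"] by blast
    have "?t a b x = ?t a c (?t b c (?t a c x))" using conj[of a b c] ab c False by auto
    then show ?thesis using step[of a c] step[of b c] ab c by auto
  qed
qed

section \<open>Permutations acting on a partial order\<close>

lemma rel_of_lift:
  assumes "rel_of N r x y" "r \<in> Univ N" "\<pi> \<in> Fix {}" "lift_perm M \<pi> r = r"
  shows "rel_of N r (lift_perm M \<pi> x) (lift_perm M \<pi> y)"
proof -
  have xy: "x \<in> Univ N" "y \<in> Univ N" "opair M x y \<in> elts M r"
    using assms(1,2) by (auto simp: rel_of_N_iff elts_N)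
  then have "lift_perm M \<pi> (opair M x y) \<in> elts M r"
    using elts_lift[OF in_Univ[OF assms(2)] Fix_image[OF assms(3)]] assms(4) by auto
  then show ?thesis
    using xy assms lift_in_N_bij in_Univ by (simp add: rel_of_N_iff elts_N lift_opair)
qed

lemma lift_elts:
  assumes "x \<in> elts M p" "p \<in> Univ M" "\<pi> \<in> Fix E" "lift_perm M \<pi> p = p"
  shows "lift_perm M \<pi> x \<in> elts M p"
  using elts_lift[OF assms(2) Fix_image[OF assms(3)]] assms(1,4) by auto

text \<open>On an element of the model \<open>\<pi>\<close> acts like a permutation \<open>\<rho>\<close> of finite order \<open>n\<close>, and
  \<open>x < \<rho> x\<close> would give \<open>x < \<rho> x < \<dots> < \<rho>^n x = x\<close>.\<close>

lemma lift_comparable_imp_eq: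
  assumes po: "is_poset N p r" and pr: "p \<in> Univ N" "r \<in> Univ N"
    and E: "supports E p" "supports E r"
    and x: "x \<in> elts M p" and \<pi>: "\<pi> \<in> Fix E" and rel: "rel_of N r x (lift_perm M \<pi> x)"
  shows "lift_perm M \<pi> x = x"
proof -
  have xN: "x \<in> Univ N" using x pr transitive by blast
  obtain \<rho> X where \<rho>: "finite X" "X \<subseteq> Atoms M - E" "\<rho> permutes X"
    "lift_perm M \<rho> x = lift_perm M \<pi> x"
    using agreeing_finite_permutation[OF xN \<pi>] .
  have \<rho>E: "\<rho> \<in> Fix E" using permutes_fixing[OF \<rho>(3,2)] .
  have \<rho>0: "\<rho> \<in> Fix {}" using \<rho>E Fix_antimono by blast
  have fixed: "lift_perm M \<rho> p = p" "lift_perm M \<rho> r = r" using E \<rho>E by (auto simp: supports_def)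
  define q where "q i = (lift_perm M \<rho> ^^ i) x" for i
  have q: "q i \<in> elts M p" for i
    using x lift_elts[OF _ in_Univ[OF pr(1)] \<rho>E fixed(1)] by (induction i) (simp_all add: q_def)
  have step: "rel_of N r (q i) (q (Suc i))" for i
    using rel rel_of_lift[OF _ pr(2) \<rho>0 fixed(2)] by (induction i) (simp_all add: q_def \<rho>(4))
  have refl: "reflp_on (elts M p) (rel_of N r)" and antisym: "antisymp_on (elts M p) (rel_of N r)"
    and trans: "transp_on (elts M p) (rel_of N r)"
    using po pr by (simp_all add: is_poset_def elts_N)
  \<comment> \<open>The chain starts at \<open>q 1\<close> rather than at \<open>q 0\<close>: once
    \<open>q n\<close> is known to be \<open>x\<close>, it puts \<open>q 1\<close> below
    \<open>x\<close>, while the first step puts \<open>x\<close> below \<open>q 1\<close>.\<close>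
  have chain: "rel_of N r (q 1) (q (Suc m))" for m
  proof (induction m)
    case 0
    then show ?case using refl q by (auto dest: reflp_onD)
  next
    case (Suc m)
    then show ?case using trans q step[of "Suc m"] by (auto dest: transp_onD)
  qed
  have "permutation \<rho>" using \<rho> permutation_permutes by blast
  then obtain n where n: "\<rho> ^^ n = id" "n > 0" by (rule permutation_is_nilpotent)
  have pow: "q i = lift_perm M (\<rho> ^^ i) x \<and> \<rho> ^^ i \<in> Fix {}" for i
  proof (induction i)
    case 0
    then show ?case using in_Univ[OF xN] by (simp add: q_def lift_id fixing_def bij_betw_def)
  next
    case (Suc i)
    then have i: "\<rho> ^^ i \<in> Fix {}" by blast
    have "q (Suc i) = lift_perm M \<rho> (q i)" by (simp add: q_def)
    also have "\<dots> = lift_perm M (\<rho> ^^ Suc i) x"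
      using Suc lift_comp[OF in_Univ[OF xN] Fix_image[OF \<rho>0] Fix_image[OF i]]
      by (simp only: funpow.simps)
    finally show ?case using Fix_comp[OF \<rho>0 i] by (simp only: funpow.simps)
  qed
  have "q n = x" using pow[of n] n(1) in_Univ[OF xN] by (simp add: lift_id)
  moreover obtain m where "n = Suc m" using n(2) by (metis gr0_implies_Suc)
  ultimately have "rel_of N r (q 1) x" using chain[of m] by simp
  moreover have "rel_of N r x (q 1)" using step[of 0] by (simp add: q_def)
  ultimately have "q 1 = x" using antisym x q[of 1] by (auto dest: antisymp_onD)
  then show ?thesis by (simp add: q_def \<rho>(4))
qed

end


section \<open>Finiteness, ordinals and cardinalities in the Fraenkel model\<close>

context permutation_submodel
begin

lemma Mem_num_iff: "Mem N (num M i) (num M j) \<longleftrightarrow> i < j"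
proof -
  have "Mem N (num M i) (num M j) \<longleftrightarrow> num M i \<in> elts M (num M j)"
    by (simp add: elts_def Mem_N num_in_Univ)
  also have "\<dots> \<longleftrightarrow> i < j" using inj_num by (auto simp: elts_num inj_eq)
  finally show ?thesis .
qed

lemma is_set_N_num: "is_set N (num M n)"
  by (simp add: is_set_N num_in_N is_set_num)

lemma elts_N_num: "elts N (num M n) = num M ` {..<n}"
  by (simp add: elts_N num_in_N elts_num)

lemma is_ord_num: "is_ord N (num M n)"
  unfolding is_ord_def
proof (intro conjI allI impI)
  show "is_set N (num M n)" by (rule is_set_N_num)
  show "\<forall>x\<in>elts N (num M n). is_set N x \<and> elts N x \<subseteq> elts N (num M n)"
    by (auto simp: elts_N_num is_set_N_num)
  show "irreflp_on (elts N (num M n)) (Mem N)"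
    by (auto simp: irreflp_on_def elts_N_num Mem_num_iff)
  show "transp_on (elts N (num M n)) (Mem N)"
    by (auto simp: transp_on_def elts_N_num Mem_num_iff)
  show "totalp_on (elts N (num M n)) (Mem N)"
    by (auto simp: totalp_on_def elts_N_num Mem_num_iff) (metis nat_neq_iff)
  fix s assume s: "is_set N s" "elts N s \<subseteq> elts N (num M n)" "elts N s \<noteq> {}"
  let ?i = "LEAST i. num M i \<in> elts N s"
  obtain x where x: "x \<in> elts N s" using s(3) by blast
  then obtain j where "num M j \<in> elts N s" using s(2) unfolding elts_N_num by blast
  then have i: "num M ?i \<in> elts N s" by (rule LeastI)
  moreover have "num M ?i = y \<or> Mem N (num M ?i) y" if y: "y \<in> elts N s" for y
  proof -
    obtain k where k: "y = num M k" using y s(2) unfolding elts_N_num by blast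
    then have "?i \<le> k" using y by (intro Least_le) simp
    then show ?thesis unfolding k Mem_num_iff by (cases "?i = k") simp_all
  qed
  ultimately show "\<exists>x\<in>elts N s. \<forall>y\<in>elts N s. x = y \<or> Mem N x y" by blast
qed

lemma is_nat_num: "is_nat N (num M n)"
  unfolding is_nat_def
proof (intro conjI ballI is_ord_num)
  fix k assume "k \<in> insert (num M n) (elts N (num M n))"
  then obtain i where k: "k = num M i" by (auto simp: elts_N_num)
  show "elts N k = {} \<or> (\<exists>j\<in>Univ N. elts N k = insert j (elts N j))"
  proof (cases i)
    case 0
    then show ?thesis by (simp add: k elts_N_num)
  next
    case (Suc j)
    then show ?thesis using num_in_N
      by (intro disjI2 bexI[of _ "num M j"]) (simp_all add: k elts_N_num lessThan_Suc)
  qed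
qed

lemma is_ord_in_N: "is_ord N k \<Longrightarrow> k \<in> Univ N"
  unfolding is_ord_def is_set_N by simp

text \<open>There are no nonstandard numbers, because membership is well-founded in HOL: every
  nonzero element at or below \<open>n\<close> adds a single element to a predecessor, and the
  predecessor is again below \<open>n\<close>.\<close>

lemma finite_elts_nat:
  assumes "is_nat N n"
  shows "finite (elts N n)"
proof -
  have n: "is_ord N n" using assms by (simp add: is_nat_def)
  have "k \<in> insert n (elts N n) \<Longrightarrow> finite (elts N k)" if "k \<in> Univ M" for k
    using that
  proof (induction rule: mem_induct)
    case (step k)
    have sub: "k \<in> Univ N" "elts N k \<subseteq> elts N n"
      using step.prems n is_ord_in_N[OF n] elts_subset_Univ[of N n] by (auto simp: is_ord_def)
    have "elts N k = {} \<or> (\<exists>j\<in>Univ N. elts N k = insert j (elts N j))"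
      using assms step.prems unfolding is_nat_def by blast
    then show ?case
    proof
      assume "\<exists>j\<in>Univ N. elts N k = insert j (elts N j)"
      then obtain j where j: "elts N k = insert j (elts N j)" by blast
      then have "j \<in> elts M k" using sub(1) elts_N by blast
      moreover have "j \<in> insert n (elts N n)" using j sub(2) by blast
      ultimately have "finite (elts N j)" by (rule step.IH)
      then show ?thesis by (simp add: j)
    qed simp
  qed
  then show ?thesis using is_ord_in_N[OF n] in_Univ by simp
qed

text \<open>Finiteness is absolute: a bijection between finite extensions has a finite graph, and
  the model contains every finite set of its objects.\<close>

lemma finite_in_iff:
  assumes "x \<in> Univ N"
  shows "finite_in N x \<longleftrightarrow> finite (elts N x)"
proof
  assume "finite_in N x"
  then obtain n f where n: "is_nat N n" "is_bij N f x n"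
    by (auto simp: finite_in_def equipotent_def)
  then have "card_le N x n" by (auto simp: card_le_def is_bij_def)
  then show "finite (elts N x)"
    using card_le_imp_lepoll finite_elts_nat[OF n(1)] lepoll_iff by (metis finite_surj)
next
  assume fin: "finite (elts N x)"
  obtain h where h: "bij_betw h (elts N x) {0..<card (elts N x)}"
    using ex_bij_betw_finite_nat[OF fin] by blast
  let ?n = "num M (card (elts N x))" and ?f = "num M \<circ> h"
  have "bij_betw (num M) {..<card (elts N x)} (elts M ?n)"
    using inj_num by (auto simp: bij_betw_def elts_num intro: inj_on_subset)
  then have bij: "bij_betw ?f (elts M x) (elts M ?n)"
    using bij_betw_trans[OF h[unfolded atLeast0LessThan]] elts_N[OF assms] by metis
  then have sub: "?f ` elts M x \<subseteq> elts M ?n" by (rule bij_betw_imp_surj_on[THEN equalityD1])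
  have "finite (graph x ?f)" using fin assms by (simp add: graph_def elts_N)
  then have "coll M (graph x ?f) \<in> Univ N"
    using graph_subset[OF assms num_in_N sub] by (rule coll_finite_in_N)
  then have "is_bij N (coll M (graph x ?f)) x ?n"
    using bij by (rule is_bij_graph[OF assms num_in_N sub])
  then show "finite_in N x" using is_nat_num by (auto simp: finite_in_def equipotent_def)
qed

text \<open>No atoms occur hereditarily in an ordinal, so by induction along membership nothing
  moves. The elements come first, since transitivity keeps the induction inside
  \<open>k\<close>.\<close>

lemma lift_ord:
  assumes k: "is_ord N k" and \<pi>: "\<pi> ` Atoms M \<subseteq> Atoms M"
  shows "lift_perm M \<pi> k = k" "x \<in> elts N k \<Longrightarrow> lift_perm M \<pi> x = x"
proof -
  have kN: "k \<in> Univ N" using is_ord_in_N[OF k] .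
  have fixed: "lift_perm M \<pi> x = x" if "is_set M x" "\<And>y. y \<in> elts M x \<Longrightarrow> lift_perm M \<pi> y = y" for x
    using that by (simp add: lift_eq_coll coll_elts)
  have *: "x \<in> elts N k \<Longrightarrow> lift_perm M \<pi> x = x" if "x \<in> Univ M" for x
    using that
  proof (induction rule: mem_induct)
    case (step x)
    have "is_set N x" "elts N x \<subseteq> elts N k" using k step.prems by (auto simp: is_ord_def)
    then have x: "is_set M x" "elts M x \<subseteq> elts N k" by (auto simp: is_set_N elts_N)
    show ?case
    proof (rule fixed[OF x(1)])
      fix y assume "y \<in> elts M x"
      then have "y \<in> elts N k" using x(2) by (rule rev_subsetD)
      with \<open>y \<in> elts M x\<close> show "lift_perm M \<pi> y = y" by (rule step.IH)
    qed
  qed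
  show **: "lift_perm M \<pi> x = x" if "x \<in> elts N k" for x
    using that elts_subset_Univ[of N k] in_Univ by (intro *) auto
  show "lift_perm M \<pi> k = k"
  proof (rule fixed)
    show "is_set M k" using k by (simp add: is_ord_def is_set_N)
    show "lift_perm M \<pi> y = y" if "y \<in> elts M k" for y
      using that elts_N[OF kN] by (intro **) simp
  qed
qed

end

context fraenkel
begin

text \<open>Let \<open>E\<close> be a finite support of one part. If both parts had atoms outside
  \<open>E\<close>, the transposition of two such atoms would fix that part and yet carry an atom
  out of it; so one part is contained in \<open>E\<close>.\<close>

lemma amorphous_Atoms: "amorphous N (coll M (Atoms M))"
proof -
  let ?A = "coll M (Atoms M)"
  have AN: "?A \<in> Univ N"
    using Fix_image[of _ "{}"] Atoms_subset_N
    by (intro coll_in_N_Fix[of _ "{}"] small_Atoms) (auto simp: lift_atom)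
  have e: "elts N ?A = Atoms M" by (rule elts_coll_N[OF small_Atoms AN])
  have "finite_in N y \<or> finite_in N z"
    if yz: "is_set N y" "is_set N z" "elts N y \<union> elts N z = Atoms M" "elts N y \<inter> elts N z = {}" for y z
  proof -
    have N: "y \<in> Univ N" "z \<in> Univ N" using yz by (auto simp: is_set_N)
    obtain E where E: "E \<subseteq> Atoms M" "finite E" "supports E y"
      using finite_support_exists[OF N(1)] .
    have "elts N y \<subseteq> E \<or> elts N z \<subseteq> E"
    proof (rule ccontr)
      assume "\<not> ?thesis"
      then obtain b c where bc: "b \<in> elts N y" "b \<notin> E" "c \<in> elts N z" "c \<notin> E" by blast
      then have A: "b \<in> Atoms M" "c \<in> Atoms M" using yz(3) by auto
      let ?t = "Transposition.transpose b c"
      have t: "?t \<in> Fix E" using A bc by (intro transpose_fixing) auto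
      then have "lift_perm M ?t y = y" using E(3) by (simp add: supports_def)
      then have "lift_perm M ?t b \<in> elts M y"
        using bc(1) N(1) t in_Univ by (intro lift_elts) (simp_all add: elts_N)
      then have "c \<in> elts N y" using A N(1) by (simp add: lift_atom elts_N)
      then show False using bc(3) yz(4) by blast
    qed
    then show ?thesis using E(2) N by (auto simp: finite_in_iff dest: finite_subset)
  qed
  then show ?thesis
    using is_set_coll_N[OF small_Atoms AN] infinite_Atoms
    by (auto simp: amorphous_def e finite_in_iff[OF AN])
qed

text \<open>The common support is a support of the injection.\<close>

lemma card_le_common_support:
  assumes "card_le N c k" and k: "\<And>y. y \<in> elts N k \<Longrightarrow> supports {} y"
  obtains D where "finite D" "\<And>x. x \<in> elts N c \<Longrightarrow> supports D x"
proof -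
  obtain f where f: "is_inj N f c k" using assms(1) by (auto simp: card_le_def)
  then obtain h where h: "h ` elts N c \<subseteq> elts N k" "\<And>x. x \<in> elts N c \<Longrightarrow> rel_of N f x (h x)"
    by (rule is_injE) blast
  have inj: "rel_of N f x y \<Longrightarrow> rel_of N f x' y \<Longrightarrow> x = x'" for x x' y
    using f by (auto simp: is_inj_def)
  have fN: "f \<in> Univ N" using f by (simp add: is_inj_def is_fun_def is_rel_def is_set_N)
  obtain D where "D \<subseteq> Atoms M" and D: "finite D" "supports D f"
    using finite_support_exists[OF fN] .
  have "supports D x" if x: "x \<in> elts N c" for x
    unfolding supports_def
  proof
    fix \<pi> assume \<pi>: "\<pi> \<in> Fix D"
    then have \<pi>0: "\<pi> \<in> Fix {}" using Fix_antimono by blast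
    have "rel_of N f (lift_perm M \<pi> x) (lift_perm M \<pi> (h x))"
      using h(2)[OF x] D(2) \<pi> by (intro rel_of_lift fN \<pi>0) (simp_all add: supports_def)
    moreover have "lift_perm M \<pi> (h x) = h x"
      using k[of "h x"] h(1) x \<pi>0 by (auto simp: supports_def)
    ultimately show "lift_perm M \<pi> x = x" using inj h(2)[OF x] by metis
  qed
  with D(1) that show thesis by blast
qed

text \<open>If \<open>E\<close> supports all elements on both sides, it supports each pair of them,
  so every HOL injection has its graph in the model, even one obtained by HOL choice.\<close>

lemma card_leI:
  assumes ab: "a \<in> Univ N" "b \<in> Univ N" and E: "E \<subseteq> Atoms M" "finite E"
    and a: "\<And>x. x \<in> elts N a \<Longrightarrow> supports E x" and b: "\<And>y. y \<in> elts N b \<Longrightarrow> supports E y"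
    and le: "elts N a \<lesssim> elts N b"
  shows "card_le N a b"
proof -
  obtain f where f: "inj_on f (elts M a)" "f ` elts M a \<subseteq> elts M b"
    using le ab by (auto simp: lepoll_def elts_N)
  have "lift_perm M \<pi> q = q" if "\<pi> \<in> Fix E" "q \<in> graph a f" for \<pi> q
  proof -
    from that(2) obtain x where x: "x \<in> elts M a" "q = opair M x (f x)" unfolding mem_graph by blast
    then have "x \<in> elts N a" "f x \<in> elts N b" using f(2) ab by (auto simp: elts_N)
    then have "lift_perm M \<pi> x = x" "lift_perm M \<pi> (f x) = f x"
      using a b that(1) by (simp_all add: supports_def)
    moreover have "x \<in> Univ M" "f x \<in> Univ M"
      using x(1) f(2) elts_subset_Univ[of M a] elts_subset_Univ[of M b] by blast+
    ultimately show ?thesis by (simp add: x(2) lift_opair)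
  qed
  then have "coll M (graph a f) \<in> Univ N"
    using small_graph[OF ab f(2)] graph_subset[OF ab f(2)] by (intro coll_in_N_Fix[OF _ _ E]) simp_all
  then show ?thesis
    using is_inj_graph[OF ab f(2) _ f(1)] unfolding card_le_def by blast
qed

text \<open>The common core of both claims, for a bound \<open>k\<close> that is infinite and whose
  elements are fixed by every permutation of the atoms.\<close>

lemma card_le_if_antichains_card_le:
  assumes po: "is_poset N p r"
    and chains: "\<And>c. is_chain N p r c \<Longrightarrow> finite_in N c"
    and antichains: "\<And>c. is_antichain N p r c \<Longrightarrow> card_le N c k"
    and kN: "k \<in> Univ N" and inf: "infinite (elts N k)"
    and k: "\<And>y. y \<in> elts N k \<Longrightarrow> supports {} y"
  shows "card_le N p k"
proof -
  have pr: "p \<in> Univ N" "r \<in> Univ N" using po by (auto simp: is_poset_def is_rel_def is_set_N)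
  obtain E1 where E1: "E1 \<subseteq> Atoms M" "finite E1" "supports E1 p"
    using finite_support_exists[OF pr(1)] .
  obtain E2 where E2: "E2 \<subseteq> Atoms M" "finite E2" "supports E2 r"
    using finite_support_exists[OF pr(2)] .
  define E where "E = E1 \<union> E2"
  have E: "E \<subseteq> Atoms M" "finite E" "supports E p" "supports E r"
    using E1 E2 by (auto simp: E_def intro: supports_mono)
  have fixed: "lift_perm M \<pi> p = p" "lift_perm M \<pi> r = r" if "\<pi> \<in> Fix E" for \<pi>
    using E that by (auto simp: supports_def)
  have pN: "x \<in> Univ N" if "x \<in> elts M p" for x using that transitive[OF pr(1)] by blast
  have orbit_in: "lift_perm M \<pi> x \<in> elts M p" if "x \<in> elts M p" "\<pi> \<in> Fix E" for \<pi> x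
    using that in_Univ[OF pr(1)] fixed by (intro lift_elts)
  have supp: "supports E x" if x: "x \<in> elts M p" for x
  proof -
    let ?O = "(\<lambda>\<pi>. lift_perm M \<pi> x) ` Fix E"
    have xM: "x \<in> Univ M" using x pN in_Univ by blast
    have sub: "?O \<subseteq> elts M p" using x orbit_in by blast
    have s: "small M ?O" using small_subset[OF small_elts sub] pr(1) in_Univ by blast
    have ON: "coll M ?O \<in> Univ N"
    proof (rule coll_in_N_Fix[OF s _ E(1,2)])
      show "?O \<subseteq> Univ N" using sub pN by blast
      fix \<pi> y assume \<pi>: "\<pi> \<in> Fix E" and "y \<in> ?O"
      then obtain \<sigma> where \<sigma>: "\<sigma> \<in> Fix E" "y = lift_perm M \<sigma> x" by blast
      have "lift_perm M \<pi> y = lift_perm M (\<pi> \<circ> \<sigma>) x"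
        using \<pi> \<sigma> Fix_image xM by (simp only: lift_comp)
      then show "lift_perm M \<pi> y \<in> ?O" using Fix_comp[OF \<pi> \<sigma>(1)] by blast
    qed
    have eO: "elts N (coll M ?O) = ?O" by (rule elts_coll_N[OF s ON])
    \<comment> \<open>If \<open>y\<close> and \<open>z\<close> are the images of \<open>x\<close>
      under \<open>\<sigma>\<close> and \<open>\<tau>\<close>, then \<open>\<tau>\<close> after the
      inverse of \<open>\<sigma>\<close> fixes \<open>E\<close> and sends \<open>y\<close> to
      \<open>z\<close>, so comparability forces equality.\<close>
    have incomparable: "y = z" if "y \<in> ?O" "z \<in> ?O" "rel_of N r y z" for y z
    proof -
      obtain \<sigma> \<tau> where \<sigma>: "\<sigma> \<in> Fix E" "y = lift_perm M \<sigma> x" and \<tau>: "\<tau> \<in> Fix E" "z = lift_perm M \<tau> x"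
        using \<open>y \<in> ?O\<close> \<open>z \<in> ?O\<close> by blast
      let ?i = "inv_into (Atoms M) \<sigma>"
      have i: "?i \<in> Fix E" using Fix_inv_into[OF \<sigma>(1) E(1)] .
      have "y \<in> elts M p" using that(1) sub by blast
      then have yM: "y \<in> Univ M" using pN in_Univ by blast
      have "lift_perm M (\<tau> \<circ> ?i) y = lift_perm M \<tau> (lift_perm M ?i y)"
        by (rule lift_comp[OF yM Fix_image[OF \<tau>(1)] Fix_image[OF i], symmetric])
      also have "\<dots> = z"
        using lift_inv_into(1)[OF xM Fix_bij[OF \<sigma>(1)]] \<sigma>(2) \<tau>(2) by simp
      finally have z: "lift_perm M (\<tau> \<circ> ?i) y = z" .
      have "lift_perm M (\<tau> \<circ> ?i) y = y"
        by (rule lift_comparable_imp_eq[OF po pr E(3,4) \<open>y \<in> elts M p\<close> Fix_comp[OF \<tau>(1) i]])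
          (simp only: z that(3))
      with z show ?thesis by simp
    qed
    have "is_antichain N p r (coll M ?O)"
      unfolding is_antichain_def eO
    proof (intro conjI)
      show "is_set N (coll M ?O)" by (rule is_set_coll_N[OF s ON])
      show "?O \<subseteq> elts N p" using sub pr(1) by (simp add: elts_N)
      show "pairwise (\<lambda>x y. \<not> rel_of N r x y \<and> \<not> rel_of N r y x) ?O"
      proof (rule pairwiseI)
        fix y z assume "y \<in> ?O" "z \<in> ?O" "y \<noteq> z"
        then show "\<not> rel_of N r y z \<and> \<not> rel_of N r z y"
          using incomparable[of y z] incomparable[of z y] by metis
      qed
    qed
    from antichains[OF this] obtain D where D: "finite D" "\<And>y. y \<in> ?O \<Longrightarrow> supports D y"
      using card_le_common_support[OF _ k, of "coll M ?O"] unfolding eO by blast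
    show ?thesis
      by (rule supports_if_orbit_supported[OF pN[OF x] E(2) D(1)]) (use D(2) in blast)
  qed
  have subsets: "small M C \<and> coll M C \<in> Univ N" if C: "C \<subseteq> elts N p" for C
  proof -
    have C': "C \<subseteq> elts M p" using C pr(1) by (simp add: elts_N)
    have s: "small M C" using small_subset[OF small_elts C'] pr(1) in_Univ by blast
    have "C \<subseteq> Univ N" using C' pN by blast
    then have "coll M C \<in> Univ N"
      using supp C' by (intro coll_in_N_Fix[OF s _ E(1,2)]) (auto simp: supports_def)
    with s show ?thesis by simp
  qed
  \<comment> \<open>By \<open>subsets\<close>, HOL chains and antichains are now chains and
    antichains of the model, and the combinatorial lemma applies with comparability as
    adjacency.\<close>
  have "elts N p \<lesssim> elts N k"
  proof (rule lepoll_if_cliques_finite_independent_sets_lepoll[OF inf, where Q = "rel_of N r"])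
    fix C assume C: "C \<subseteq> elts N p"
    then have s: "small M C" and CN: "coll M C \<in> Univ N" using subsets by auto
    note set = is_set_coll_N[OF s CN] elts_coll_N[OF s CN]
    show "finite C" if "\<And>x y. x \<in> C \<Longrightarrow> y \<in> C \<Longrightarrow> x \<noteq> y \<Longrightarrow> rel_of N r x y \<or> rel_of N r y x"
    proof -
      have "is_chain N p r (coll M C)"
        using that C by (auto simp: is_chain_def set totalp_on_def)
      then show ?thesis using chains finite_in_iff[OF CN] set by simp
    qed
    show "C \<lesssim> elts N k" if "pairwise (\<lambda>x y. \<not> rel_of N r x y \<and> \<not> rel_of N r y x) C"
    proof -
      have "is_antichain N p r (coll M C)" using that C by (simp add: is_antichain_def set)
      from card_le_imp_lepoll[OF antichains[OF this]] show ?thesis by (simp add: set)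
    qed
  qed
  moreover have "supports E y" if "y \<in> elts N k" for y using supports_mono[OF k[OF that]] by simp
  ultimately show ?thesis
    using supp pr(1) kN E(1,2) by (intro card_leI) (simp_all add: elts_N)
qed

lemma supports_ord:
  assumes "is_ord N k"
  shows "supports {} k" "y \<in> elts N k \<Longrightarrow> supports {} y"
  using lift_ord[OF assms] Fix_image by (auto simp: supports_def)

lemma card_le_regular_aleph:
  assumes "regular_aleph N k" "is_poset N p r"
    and "\<And>c. is_chain N p r c \<Longrightarrow> finite_in N c"
    and "\<And>c. is_antichain N p r c \<Longrightarrow> card_le N c k"
  shows "card_le N p k"
proof -
  have k: "is_ord N k" "\<not> finite_in N k" using assms(1) by (auto simp: regular_aleph_def is_aleph_def)
  then show ?thesis
    using card_le_if_antichains_card_le[OF assms(2-4) is_ord_in_N[OF k(1)]] supports_ord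
      finite_in_iff[OF is_ord_in_N[OF k(1)]] by blast
qed

text \<open>The empty antichain already provides an \<open>\<omega>\<close> of the model.\<close>

lemma countable_in_if_antichains_countable:
  assumes "is_poset N p r"
    and "\<And>c. is_chain N p r c \<Longrightarrow> finite_in N c"
    and "\<And>c. is_antichain N p r c \<Longrightarrow> countable_in N c"
  shows "countable_in N p"
proof -
  have e: "coll M {} \<in> Univ N" using coll_finite_in_N[of "{}"] by simp
  have "is_antichain N p r (coll M {})"
    using is_set_coll_N[OF small_empty e] elts_coll_N[OF small_empty e]
    by (simp add: is_antichain_def)
  from assms(3)[OF this] obtain w where w: "is_omega N w" by (auto simp: countable_in_def)
  then have wN: "w \<in> Univ N" and we: "elts N w = {n. is_nat N n}" by (auto simp: is_omega_def is_set_N)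
  have "range (num M) \<subseteq> elts N w" using is_nat_num by (auto simp: we)
  then have inf: "infinite (elts N w)"
    using finite_subset finite_imageD[OF _ inj_num] by blast
  have "supports {} y" if "y \<in> elts N w" for y
    using that supports_ord(1) by (simp add: we is_nat_def)
  moreover have "card_le N c w" if c: "is_antichain N p r c" for c
  proof -
    obtain w' where w': "is_omega N w'" "card_le N c w'"
      using assms(3)[OF c] by (auto simp: countable_in_def)
    \<comment> \<open>Each use of \<open>countable_in\<close> brings its own
      \<open>\<omega>\<close>; extensionality identifies them, so that one bound serves for all
      antichains.\<close>
    have "w' = w"
    proof (rule is_set_eqI)
      show "is_set M w'" "is_set M w" using w w'(1) by (simp_all add: is_omega_def is_set_N)
      have "w' \<in> Univ N" "elts N w' = elts N w" using w w'(1) by (simp_all add: is_omega_def is_set_N)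
      then show "elts M w' = elts M w" using wN elts_N[of w'] elts_N[of w] by simp
    qed
    with w'(2) show ?thesis by simp
  qed
  ultimately have "card_le N p w"
    using card_le_if_antichains_card_le[OF assms(1,2) _ wN inf] by blast
  with w show ?thesis by (auto simp: countable_in_def)
qed

end


theorem theorem4p7:
  fixes V :: "'a zfa_struct"
  assumes "zfc_universe V"
  shows "\<exists>N :: 'a zfa_struct. permutation_model N \<and> zfa_model N \<and>
    (\<exists>x. amorphous N x) \<and>
    (\<forall>p r. is_poset N p r \<longrightarrow>
       (\<forall>c. is_chain N p r c \<longrightarrow> finite_in N c) \<longrightarrow>
       (\<forall>c. is_antichain N p r c \<longrightarrow> countable_in N c) \<longrightarrow>
       countable_in N p) \<and>
    (\<forall>k. regular_aleph N k \<longrightarrow>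
       (\<forall>p r. is_poset N p r \<longrightarrow>
          (\<forall>c. is_chain N p r c \<longrightarrow> finite_in N c) \<longrightarrow>
          (\<forall>c. is_antichain N p r c \<longrightarrow> card_le N c k) \<longrightarrow>
          card_le N p k))"
proof -
  obtain M :: "'a zfa_struct" where M: "zfa_universe M" "infinite (Atoms M)"
    using zfa_universe_with_infinitely_many_atoms[OF assms] .
  interpret fraenkel M
    using M by (intro fraenkel.intro fraenkel_axioms.intro)
  show ?thesis
  proof (intro exI[of _ N] conjI allI impI)
    show "permutation_model N" by (rule permutation_model_N)
    show "zfa_model N" by (rule zfa_model_N)
    show "\<exists>x. amorphous N x" using amorphous_Atoms by blast
    show "countable_in N p"
      if "is_poset N p r" "\<forall>c. is_chain N p r c \<longrightarrow> finite_in N c"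
        "\<forall>c. is_antichain N p r c \<longrightarrow> countable_in N c" for p r
      using countable_in_if_antichains_countable that by simp
    show "card_le N p k"
      if "regular_aleph N k" "is_poset N p r" "\<forall>c. is_chain N p r c \<longrightarrow> finite_in N c"
        "\<forall>c. is_antichain N p r c \<longrightarrow> card_le N c k" for k p r
      using card_le_regular_aleph[OF that(1,2)] that(3,4) by simp
  qed
qed

end
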